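(* Every Hausdorff feathered strongly topological gyrogroup with countable $cs^{*}$-character is metrizable.
   Context: A gyrogroup is a nonempty set $G$ with a binary operation $\oplus$ such that: (G1) there is a unique identity element $0\in G$ with $0\oplus a=a=a\oplus 0$ for all $a\in G$; (G2) for each $x\in G$ there is a unique inverse $\ominus x\in G$ with $\ominus x\oplus x=0=x\oplus(\ominus x)$; (G3) for all $x,y\in G$ there is an automorphism $\mathrm{gyr}[x,y]$ of $(G,\oplus)$ with $x\oplus(y\oplus z)=(x\oplus y)\oplus \mathrm{gyr}[x,y](z)$ for all $z\in G$; (G4) $\mathrm{gyr}[x\oplus y,y]=\mathrm{gyr}[x,y]$ for all $x,y\in G$. A topological gyrogroup is a gyrogroup with a topology such that $\oplus:G\times G\to G$ is jointly continuous and $x\mapsto\ominus x$ is continuous. A topological gyrogroup $G$ is a strongly topological gyrogroup if there is a neighborhood base $\mathscr{U}$ of $0$ such that $\mathrm{gyr}[x,y](U)=U$ for every $U\in\mathscr{U}$ and all $x,y\in G$. A topological gyrogroup $G$ is feathered if it contains a nonempty compact set $K$ of countable character in $G$, i.e. there is a countable family of open sets containing $K$ such that every open set containing $K$ contains a member of the family. A family $\mathcal{N}$ of subsets of a space $X$ is a $cs^{*}$-network at $x\in X$ if for each sequence $(x_n)_{n\in\mathbb{N}}$ in $X$ converging to $x$ and each neighborhood $O_x$ of $x$ there is $N\in\mathcal{N}$ such that $x\in N\subset O_x$ and $\{n\in\mathbb{N}:x_n\in N\}$ is infinite. The $cs^{*}$-character of a topological gyrogroup $G$ is the least cardinality of a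 $cs^{*}$-network at the identity $0$; thus $G$ has countable $cs^*$-character iff it has a countable $cs^*$-network at $0$. All topological spaces are assumed to be Hausdorff. *)

theory Defs
  imports "HOL-Analysis.Analysis"
begin

(* The maps gyr x y are data of the structure. Only their restriction to G matters,
   so equality of gyrations in gyr_loop is equality on G. *)
locale gyrogroup =
  fixes G :: "'a set"
    and add :: "'a \<Rightarrow> 'a \<Rightarrow> 'a"  (infixl "\<oplus>" 65)
    and zero :: 'a  ("\<zero>")
    and neg :: "'a \<Rightarrow> 'a"  ("\<ominus> _" [81] 80)
    and gyr :: "'a \<Rightarrow> 'a \<Rightarrow> 'a \<Rightarrow> 'a"
  assumes add_closed: "\<lbrakk>x \<in> G; y \<in> G\<rbrakk> \<Longrightarrow> x \<oplus> y \<in> G"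
    and zero_closed: "\<zero> \<in> G"
    and zero_identity: "a \<in> G \<Longrightarrow> \<zero> \<oplus> a = a \<and> a \<oplus> \<zero> = a"
    and zero_unique: "\<lbrakk>e \<in> G; \<And>a. a \<in> G \<Longrightarrow> e \<oplus> a = a \<and> a \<oplus> e = a\<rbrakk> \<Longrightarrow> e = \<zero>"
    and neg_closed: "x \<in> G \<Longrightarrow> \<ominus> x \<in> G"
    and neg_inverse: "x \<in> G \<Longrightarrow> \<ominus> x \<oplus> x = \<zero> \<and> x \<oplus> (\<ominus> x) = \<zero>"
    and neg_unique: "\<lbrakk>x \<in> G; y \<in> G; y \<oplus> x = \<zero>; x \<oplus> y = \<zero>\<rbrakk> \<Longrightarrow> y = \<ominus> x"
    and gyr_bij: "\<lbrakk>x \<in> G; y \<in> G\<rbrakk> \<Longrightarrow> bij_betw (gyr x y) G G"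
    and gyr_hom: "\<lbrakk>x \<in> G; y \<in> G; a \<in> G; b \<in> G\<rbrakk>
                    \<Longrightarrow> gyr x y (a \<oplus> b) = gyr x y a \<oplus> gyr x y b"
    and gyr_assoc: "\<lbrakk>x \<in> G; y \<in> G; z \<in> G\<rbrakk>
                    \<Longrightarrow> x \<oplus> (y \<oplus> z) = (x \<oplus> y) \<oplus> gyr x y z"
    and gyr_loop: "\<lbrakk>x \<in> G; y \<in> G; z \<in> G\<rbrakk> \<Longrightarrow> gyr (x \<oplus> y) y z = gyr x y z"

locale topological_gyrogroup =
  gyrogroup "topspace X" add zero neg gyr
  for X :: "'a topology"
    and add :: "'a \<Rightarrow> 'a \<Rightarrow> 'a"  (infixl "\<oplus>" 65)
    and zero :: 'a  ("\<zero>")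
    and neg :: "'a \<Rightarrow> 'a"  ("\<ominus> _" [81] 80)
    and gyr :: "'a \<Rightarrow> 'a \<Rightarrow> 'a \<Rightarrow> 'a" +
  assumes continuous_add: "continuous_map (prod_topology X X) X (\<lambda>(x, y). x \<oplus> y)"
    and continuous_neg: "continuous_map X X (\<lambda>x. \<ominus> x)"

(* Neighborhoods need not be open. *)
definition neighborhood_of :: "'a topology \<Rightarrow> 'a \<Rightarrow> 'a set \<Rightarrow> bool" where
  "neighborhood_of X x N \<longleftrightarrow>
     N \<subseteq> topspace X \<and> (\<exists>W. openin X W \<and> x \<in> W \<and> W \<subseteq> N)"

definition neighborhood_base_family :: "'a topology \<Rightarrow> 'a \<Rightarrow> 'a set set \<Rightarrow> bool" where
  "neighborhood_base_family X x \<U> \<longleftrightarrow>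
     (\<forall>U\<in>\<U>. neighborhood_of X x U) \<and>
     (\<forall>N. neighborhood_of X x N \<longrightarrow> (\<exists>U\<in>\<U>. U \<subseteq> N))"

locale strongly_topological_gyrogroup = topological_gyrogroup +
  assumes gyr_invariant_base:
    "\<exists>\<U>. neighborhood_base_family X \<zero> \<U> \<and>
          (\<forall>U\<in>\<U>. \<forall>x\<in>topspace X. \<forall>y\<in>topspace X. gyr x y ` U = U)"

definition countable_character_in :: "'a topology \<Rightarrow> 'a set \<Rightarrow> bool" where
  "countable_character_in X K \<longleftrightarrow>
     (\<exists>\<B>. countable \<B> \<and> (\<forall>B\<in>\<B>. openin X B \<and> K \<subseteq> B) \<and>
          (\<forall>W. openin X W \<and> K \<subseteq> W \<longrightarrow> (\<exists>B\<in>\<B>. B \<subseteq> W)))"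

definition feathered :: "'a topology \<Rightarrow> bool" where
  "feathered X \<longleftrightarrow> (\<exists>K. K \<noteq> {} \<and> compactin X K \<and> countable_character_in X K)"

definition cs_star_network_at :: "'a topology \<Rightarrow> 'a \<Rightarrow> 'a set set \<Rightarrow> bool" where
  "cs_star_network_at X x \<N> \<longleftrightarrow>
     (\<forall>N\<in>\<N>. N \<subseteq> topspace X) \<and>
     (\<forall>\<xi> :: nat \<Rightarrow> 'a. \<forall>Ox. range \<xi> \<subseteq> topspace X \<and> limitin X \<xi> x sequentially \<and>
        neighborhood_of X x Ox \<longrightarrow>
        (\<exists>N\<in>\<N>. x \<in> N \<and> N \<subseteq> Ox \<and> infinite {n. \<xi> n \<in> N}))"

(* The least cardinality of a cs*-network at x is countable. *)
definition countable_cs_star_character_at :: "'a topology \<Rightarrow> 'a \<Rightarrow> bool" where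
  "countable_cs_star_character_at X x \<longleftrightarrow>
     (\<exists>\<N>. countable \<N> \<and> cs_star_network_at X x \<N>)"

end

theory Submission
  imports Defs
begin

text \<open>By the Birkhoff--Kakutani argument, and because the feathered hypothesis provides a compact
  subgyrogroup H of countable character that contains \<zero>, it is enough to show that \<open>{\<zero>}\<close> is a
  countable intersection of neighbourhoods. Suppose it is not. Starting from H, one repeatedly passes to smaller
  compact invariant subgyrogroups M, keeping a family of cosets of M that converges to M: when M shrinks
  to \<open>M \<inter> P\<close>, with P a countable intersection of neighbourhoods, the cosets can be refined so
  that they still converge, and one new coset is added. By Zorn's lemma this ends only at \<open>M = {\<zero>}\<close>,
  and then with uncountably many cosets, that is, with points
  \<open>e i \<noteq> \<zero>\<close> indexed by an uncountable set such that every neighbourhood of \<zero> contains all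
  but finitely many of them. Every neighbourhood U of \<zero> must then contain a finite union of members of the
  cs*-network that contains all but finitely many \<open>e i\<close>, for otherwise a sequence of points
  \<open>e i\<close> with distinct indices would contradict the network property. There are only countably many such
  finite unions, so a single point \<open>e i\<close> lies in all of them, hence in every U: a contradiction.\<close>

subsection \<open>Metrization by a countable family of entourages\<close>

text \<open>The first real argument is the total \<open>f\<close>-length of some finite chain in
  \<open>S\<close> between the two points. Appending at the right end makes concatenation and
  reversal simple inductions; the infimum of these lengths will be the metric.\<close>

inductive chain_sum :: "'a set \<Rightarrow> ('a \<Rightarrow> 'a \<Rightarrow> real) \<Rightarrow> real \<Rightarrow> 'a \<Rightarrow> 'a \<Rightarrow> bool"
  for S f where
  start: "x \<in> S \<Longrightarrow> chain_sum S f 0 x x"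
| extend: "chain_sum S f a x y \<Longrightarrow> z \<in> S \<Longrightarrow> chain_sum S f (a + f y z) x z"

lemma chain_sum_in: "chain_sum S f a x y \<Longrightarrow> x \<in> S \<and> y \<in> S"
  by (induction rule: chain_sum.induct) auto

lemma chain_sum_append:
  assumes "chain_sum S f b y z" "chain_sum S f a x y"
  shows "chain_sum S f (a + b) x z"
  using assms
proof (induction rule: chain_sum.induct)
  case (start x)
  then show ?case by simp
next
  case (extend b y w z)
  then show ?case using chain_sum.extend[of S f "a + b" x w z] by (simp add: add.assoc)
qed

lemma chain_sum_single: "x \<in> S \<Longrightarrow> y \<in> S \<Longrightarrow> chain_sum S f (f x y) x y"
  using chain_sum.extend[OF chain_sum.start, of x S y f] by simp

lemma chain_sum_sym:
  assumes "chain_sum S f a x y" and sym: "\<And>x y. f x y = f y x"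
  shows "chain_sum S f a y x"
  using assms(1)
proof (induction rule: chain_sum.induct)
  case (start x)
  then show ?case by (rule chain_sum.start)
next
  case (extend a x y z)
  have "chain_sum S f (f z y) z y"
    using extend chain_sum_in by (metis chain_sum_single)
  from chain_sum_append[OF extend.IH this] show ?case
    by (simp add: sym[of z y] add.commute)
qed

lemma chain_sum_nonneg:
  assumes "chain_sum S f a x y" and "\<And>x y. 0 \<le> f x y"
  shows "0 \<le> a"
  using assms(1) by (induction rule: chain_sum.induct) (auto simp: assms(2))

text \<open>Exposes the vertices of a chain by index, so that it can be cut at a chosen
  position.\<close>

lemma chain_sum_points:
  assumes "chain_sum S f a x y"
  shows "\<exists>n p. p 0 = x \<and> p n = y \<and> range p \<subseteq> S \<and> a = (\<Sum>k<n. f (p k) (p (Suc k)))"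
  using assms
proof (induction rule: chain_sum.induct)
  case (start x)
  then show ?case by (intro exI[of _ 0] exI[of _ "\<lambda>_. x"]) auto
next
  case (extend a x y z)
  then obtain n p where p: "p 0 = x" "p n = y" "range p \<subseteq> S" "a = (\<Sum>k<n. f (p k) (p (Suc k)))"
    by blast
  let ?q = "p(Suc n := z)"
  have "range ?q \<subseteq> S" using p extend by auto
  moreover have "a + f y z = (\<Sum>k<Suc n. f (?q k) (?q (Suc k)))"
    using p by simp
  ultimately show ?case using p(1)
    by (intro exI[of _ "Suc n"] exI[of _ ?q]) auto
qed

text \<open>Frink's bisection: cut the chain at one link so that the pieces before and after it each
  have at most half the total length. By induction \<open>f\<close> across either piece is at most
  the full length, and so is the cut link; the three-term inequality \<open>quasi\<close> then costs
  the factor 2.\<close>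

lemma chain_sum_lower_bound:
  assumes nonneg: "\<And>x y. 0 \<le> f x y" and refl: "\<And>x. x \<in> S \<Longrightarrow> f x x = (0::real)"
    and quasi: "\<And>x y z w. \<lbrakk>x \<in> S; y \<in> S; z \<in> S; w \<in> S\<rbrakk>
        \<Longrightarrow> f x w \<le> 2 * Max {f x y, f y z, f z w}"
    and "chain_sum S f a x y"
  shows "f x y \<le> 2 * a"
proof -
  obtain n p where p: "p 0 = x" "p n = y" "range p \<subseteq> S" and a: "a = (\<Sum>k<n. f (p k) (p (Suc k)))"
    using chain_sum_points[OF assms(4)] by blast
  have pS: "p k \<in> S" for k using p by auto
  define s where "s i j = (\<Sum>k\<in>{i..<j}. f (p k) (p (Suc k)))" for i j
  have split: "s i j = s i k + s k j" if "i \<le> k" "k \<le> j" for i j k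
    unfolding s_def using that by (simp add: sum.atLeastLessThan_concat)
  have s0: "0 \<le> s i j" for i j
    unfolding s_def by (intro sum_nonneg nonneg)
  have "f (p i) (p j) \<le> 2 * s i j" if "i \<le> j" for i j
    using that
  proof (induction "j - i" arbitrary: i j rule: less_induct)
    case less
    show ?case
    proof (cases "i = j")
      case True
      then show ?thesis using refl[OF pS] s0[of i j] by simp
    next
      case False
      then have ij: "i < j" using less by simp
      \<comment> \<open>Cut positions whose initial piece takes at most half of the length. The
        largest one, \<open>k\<close>, determines the link from \<open>k\<close> to
        \<open>Suc k\<close> that is cut out.\<close>
      define K where "K = {k. i \<le> k \<and> k < j \<and> s i k \<le> s i j / 2}"
      have finK: "finite K" by (rule finite_subset[of _ "{..<j}"]) (auto simp: K_def)
      have "i \<in> K" using ij s0[of i j] by (auto simp: K_def s_def)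
      define k where "k = Max K"
      have kK: "k \<in> K" using finK \<open>i \<in> K\<close> unfolding k_def by (intro Max_in) auto
      then have k: "i \<le> k" "k < j" "s i k \<le> s i j / 2" by (auto simp: K_def)
      \<comment> \<open>By maximality of \<open>k\<close> the piece up to \<open>Suc k\<close>
        exceeds half of the length, which leaves at most half for the rest.\<close>
      have "s (Suc k) j \<le> s i j / 2"
      proof (cases "Suc k = j")
        case True
        then show ?thesis using s0[of i j] by (simp add: s_def)
      next
        case False
        have "Suc k \<notin> K" using Max_ge[OF finK, of "Suc k"] unfolding k_def by auto
        then have "s i (Suc k) > s i j / 2" using k False by (auto simp: K_def)
        then show ?thesis using split[of i "Suc k" j] k by simp
      qed
      then have 3: "f (p (Suc k)) (p j) \<le> s i j"
        using less.hyps[of j "Suc k"] k ij by force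
      have 1: "f (p i) (p k) \<le> s i j"
        using less.hyps[of k i] k by force
      have "s i j = s i k + s k (Suc k) + s (Suc k) j"
        using split[of i k j] split[of k "Suc k" j] k by simp
      moreover have "s k (Suc k) = f (p k) (p (Suc k))" by (simp add: s_def)
      ultimately have 2: "f (p k) (p (Suc k)) \<le> s i j"
        using s0[of i k] s0[of "Suc k" j] by linarith
      have "f (p i) (p j) \<le> 2 * Max {f (p i) (p k), f (p k) (p (Suc k)), f (p (Suc k)) (p j)}"
        by (intro quasi pS)
      also have "\<dots> \<le> 2 * s i j" using 1 2 3 by auto
      finally show ?thesis .
    qed
  qed
  from this[of 0 n] show ?thesis using p a by (simp add: s_def lessThan_atLeast0)
qed

text \<open>A countable base of a uniformity gives a metric. The threefold composition in
  \<open>E_trans\<close> makes the function \<open>f\<close> below satisfy the hypothesis of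
  \<open>chain_sum_lower_bound\<close>, so the chain metric lies between \<open>f / 2\<close> and
  \<open>f\<close> and induces the same topology.\<close>

proposition metrizable_space_countable_entourages:
  fixes X :: "'a topology" and E :: "nat \<Rightarrow> 'a \<Rightarrow> 'a \<Rightarrow> bool"
  assumes E_refl: "\<And>n x. x \<in> topspace X \<Longrightarrow> E n x x"
    and E_sym: "\<And>n x y. \<lbrakk>x \<in> topspace X; y \<in> topspace X; E n x y\<rbrakk> \<Longrightarrow> E n y x"
    and E_trans: "\<And>n x y z w. \<lbrakk>x \<in> topspace X; y \<in> topspace X; z \<in> topspace X; w \<in> topspace X;
        E (Suc n) x y; E (Suc n) y z; E (Suc n) z w\<rbrakk> \<Longrightarrow> E n x w"
    and E_sep: "\<And>x y. \<lbrakk>x \<in> topspace X; y \<in> topspace X; \<And>n. E n x y\<rbrakk> \<Longrightarrow> x = y"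
    and E_open: "\<And>U. openin X U \<longleftrightarrow>
        U \<subseteq> topspace X \<and> (\<forall>x\<in>U. \<exists>n. \<forall>y\<in>topspace X. E n x y \<longrightarrow> y \<in> U)"
  shows "metrizable_space X"
proof -
  define S where "S = topspace X"
  \<comment> \<open>Building the carrier into the relation lets the symmetry and composition laws
    hold without membership hypotheses.\<close>
  define R where "R n x y \<longleftrightarrow> x \<in> S \<and> y \<in> S \<and> E n x y" for n x y
  have R_refl: "x \<in> S \<Longrightarrow> R n x x" for n x using E_refl by (simp add: R_def S_def)
  have R_sym: "R n x y \<longleftrightarrow> R n y x" for n x y using E_sym by (auto simp: R_def S_def)
  have R_trans: "R (Suc n) x y \<Longrightarrow> R (Suc n) y z \<Longrightarrow> R (Suc n) z w \<Longrightarrow> R n x w" for n x y z w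
    unfolding R_def S_def using E_trans[of x y z w n] by blast
  have R_Suc: "R (Suc n) x y \<Longrightarrow> R n x y" for n x y
    using R_trans[of n x x x y] R_refl by (auto simp: R_def)
  have R_mono: "m \<le> n \<Longrightarrow> R n x y \<Longrightarrow> R m x y" for m n x y
    by (induction rule: inc_induct) (auto intro: R_Suc)
  \<comment> \<open>The exponent is the first level that separates the points. Since the levels
    decrease, \<open>f x y < (1/2) ^ n\<close> is the same as \<open>R n x y\<close>.\<close>
  define f :: "'a \<Rightarrow> 'a \<Rightarrow> real" where
    "f x y = (if \<forall>n. R n x y then 0 else (1/2) ^ (LEAST n. \<not> R n x y))" for x y
  have f_nonneg: "0 \<le> f x y" for x y by (simp add: f_def)
  have f_sym: "f x y = f y x" for x y by (simp add: f_def R_sym[of _ x y])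
  have f_refl: "x \<in> S \<Longrightarrow> f x x = 0" for x using R_refl by (simp add: f_def)
  have f_less: "f x y < (1/2) ^ n \<longleftrightarrow> R n x y" for n x y
  proof (cases "\<forall>n. R n x y")
    case True
    then show ?thesis by (simp add: f_def)
  next
    case False
    define k where "k = (LEAST n. \<not> R n x y)"
    have k: "\<not> R k x y" using False LeastI_ex[of "\<lambda>n. \<not> R n x y"] by (auto simp: k_def)
    have "R j x y \<longleftrightarrow> j < k" for j
      using not_less_Least[of j "\<lambda>n. \<not> R n x y"] R_mono[of k j x y] k
      by (auto simp: k_def not_less[symmetric])
    moreover have "f x y = (1/2) ^ k" using False by (auto simp: f_def k_def)
    ultimately show ?thesis by (simp add: power_strict_decreasing_iff)
  qed
  have f_half: "f x y = 0 \<or> (\<exists>k. f x y = (1/2) ^ k)" for x y by (auto simp: f_def)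
  have f_quasi: "f x w \<le> 2 * Max {f x y, f y z, f z w}" for x y z w
  proof (cases "f x w = 0")
    case True
    have "0 \<le> Max {f x y, f y z, f z w}" using f_nonneg[of x y] by (auto simp: le_max_iff_disj)
    then show ?thesis using True by simp
  next
    case False
    then obtain k where k: "f x w = (1/2) ^ k" using f_half by blast
    then have "\<not> R k x w" using f_less[of x w k] by simp
    then have "\<not> (R (Suc k) x y \<and> R (Suc k) y z \<and> R (Suc k) z w)" using R_trans by blast
    then have "\<not> Max {f x y, f y z, f z w} < (1/2) ^ Suc k"
      unfolding f_less[symmetric] by auto
    then show ?thesis unfolding k by simp
  qed
  define d where "d x y = Inf {a. chain_sum S f a x y}" for x y
  \<comment> \<open>The default 0 outside \<open>S\<close> is there because nonnegativity and
    symmetry of a \<open>Metric_space\<close> are demanded at all points of the type, while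
    \<open>d\<close> is an infimum of an empty set there.\<close>
  define D where "D x y = (if x \<in> S \<and> y \<in> S then d x y else 0)" for x y
  have sum_nonneg: "0 \<le> a" if "chain_sum S f a x y" for x y a
    using that f_nonneg by (rule chain_sum_nonneg)
  have bdd: "bdd_below {a. chain_sum S f a x y}" for x y
    by (rule bdd_belowI[of _ 0]) (use sum_nonneg in blast)
  have ne: "{a. chain_sum S f a x y} \<noteq> {}" if "x \<in> S" "y \<in> S" for x y
    using chain_sum_single that by fastforce
  have d_le: "d x y \<le> a" if "chain_sum S f a x y" for x y a
    unfolding d_def using that bdd by (intro cInf_lower) auto
  have le_d: "c \<le> d x y" if "x \<in> S" "y \<in> S" "\<And>a. chain_sum S f a x y \<Longrightarrow> c \<le> a" for x y c
    unfolding d_def using that ne by (intro cInf_greatest) auto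
  have d_lower: "f x y \<le> 2 * d x y" if "x \<in> S" "y \<in> S" for x y
  proof -
    have "f x y / 2 \<le> d x y"
    proof (rule le_d[OF that])
      fix a assume "chain_sum S f a x y"
      from chain_sum_lower_bound[OF f_nonneg f_refl f_quasi this]
      show "f x y / 2 \<le> a" by simp
    qed
    then show ?thesis by simp
  qed
  have d_upper: "d x y \<le> f x y" if "x \<in> S" "y \<in> S" for x y
    by (rule d_le[OF chain_sum_single[OF that]])
  interpret Metric_space S D
  proof
    show "0 \<le> D x y" for x y
      using le_d[of x y 0] sum_nonneg by (auto simp: D_def)
    have "chain_sum S f a y x" if "chain_sum S f a x y" for a x y
      using that f_sym by (rule chain_sum_sym)
    then have "{a. chain_sum S f a x y} = {a. chain_sum S f a y x}" for x y
      by blast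
    then show "D x y = D y x" for x y by (auto simp: D_def d_def)
    show "D x y = 0 \<longleftrightarrow> x = y" if "x \<in> S" "y \<in> S" for x y
    proof
      assume "D x y = 0"
      then have "f x y \<le> 0" using d_lower[OF that] that by (simp add: D_def)
      then have "f x y < (1/2) ^ n" for n by (rule order.strict_trans1) simp
      then have "R n x y" for n by (simp add: f_less)
      then show "x = y" using E_sep that by (auto simp: R_def S_def)
    next
      assume "x = y"
      then show "D x y = 0" using d_upper[of x x] d_lower[of x x] f_refl that
        by (auto simp: D_def)
    qed
    show "D x z \<le> D x y + D y z" if "x \<in> S" "y \<in> S" "z \<in> S" for x y z
    proof -
      have "d x z - d y z \<le> d x y"
      proof (rule le_d)
        fix a assume a: "chain_sum S f a x y"
        have "d x z - a \<le> d y z"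
        proof (rule le_d)
          fix b assume "chain_sum S f b y z"
          from d_le[OF chain_sum_append[OF this a]] show "d x z - a \<le> b" by simp
        qed (use that in auto)
        then show "d x z - d y z \<le> a" by simp
      qed (use that in auto)
      then show ?thesis using that by (simp add: D_def)
    qed
  qed
  have "openin mtopology U \<longleftrightarrow> openin X U" for U
  proof -
    have "(\<exists>r>0. mball x r \<subseteq> U) \<longleftrightarrow> (\<exists>n. \<forall>y\<in>S. E n x y \<longrightarrow> y \<in> U)" if "x \<in> S" for x
    proof
      assume "\<exists>r>0. mball x r \<subseteq> U"
      then obtain r where r: "r > 0" "mball x r \<subseteq> U" by blast
      obtain n where "(1/2) ^ n < r" using real_arch_pow_inv[of r "1/2"] r by auto
      have "y \<in> U" if "y \<in> S" "E n x y" for y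
      proof -
        have "f x y < (1/2) ^ n" using f_less that \<open>x \<in> S\<close> by (simp add: R_def)
        then have "D x y < r"
          using d_upper[of x y] \<open>(1/2) ^ n < r\<close> that \<open>x \<in> S\<close> by (simp add: D_def)
        then show ?thesis using r that \<open>x \<in> S\<close> by (auto simp: mball_def)
      qed
      then show "\<exists>n. \<forall>y\<in>S. E n x y \<longrightarrow> y \<in> U" by blast
    next
      assume "\<exists>n. \<forall>y\<in>S. E n x y \<longrightarrow> y \<in> U"
      then obtain n where n: "\<forall>y\<in>S. E n x y \<longrightarrow> y \<in> U" by blast
      \<comment> \<open>The extra factor 1/2 in the radius absorbs the 2 in
        \<open>f x y \<le> 2 * d x y\<close>.\<close>
      have "mball x ((1/2) ^ Suc n) \<subseteq> U"
      proof
        fix y assume "y \<in> mball x ((1/2) ^ Suc n)"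
        then have y: "y \<in> S" "d x y < (1/2) ^ Suc n" using that by (auto simp: mball_def D_def)
        then have "f x y < (1/2) ^ n" using d_lower[OF that y(1)] by simp
        then show "y \<in> U" using n y f_less by (auto simp: R_def)
      qed
      then show "\<exists>r>0. mball x r \<subseteq> U" by (intro exI[of _ "(1/2) ^ Suc n"]) auto
    qed
    then show ?thesis unfolding openin_mtopology E_open[of U] S_def[symmetric] by blast
  qed
  then have "X = mtopology" by (simp add: topology_eq)
  then show ?thesis by (simp add: metrizable_space_mtopology)
qed

subsection \<open>Gyrogroups and cosets\<close>

context gyrogroup
begin

text \<open>Adding \<open>\<ominus> a\<close> on the left turns \<open>a \<oplus> w\<close> into
  \<open>gyr (\<ominus> a) a w\<close>, and gyrations are injective. This is available before that
  gyration is known to be the identity.\<close>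

lemma left_cancel_inj:
  assumes "a \<in> G" "u \<in> G" "v \<in> G" "a \<oplus> u = a \<oplus> v"
  shows "u = v"
proof -
  have "gyr (\<ominus> a) a u = gyr (\<ominus> a) a v"
  proof -
    have "gyr (\<ominus> a) a w = \<ominus> a \<oplus> (a \<oplus> w)" if "w \<in> G" for w
    proof -
      have "gyr (\<ominus> a) a w \<in> G"
        using gyr_bij[of "\<ominus> a" a] assms(1) that neg_closed by (auto simp: bij_betw_def)
      then show ?thesis
        using gyr_assoc[of "\<ominus> a" a w] assms(1) that neg_closed neg_inverse zero_identity by simp
    qed
    then show ?thesis using assms by simp
  qed
  then show ?thesis
    using gyr_bij[of "\<ominus> a" a] assms neg_closed by (auto simp: bij_betw_def inj_on_def)
qed

lemma gyr_closed: "\<lbrakk>x \<in> G; y \<in> G; z \<in> G\<rbrakk> \<Longrightarrow> gyr x y z \<in> G"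
  using gyr_bij[of x y] by (auto simp: bij_betw_def)

lemma gyr_zero_left:
  assumes "x \<in> G" "z \<in> G"
  shows "gyr \<zero> x z = z"
proof (rule left_cancel_inj[of x])
  show "x \<oplus> gyr \<zero> x z = x \<oplus> z"
    using gyr_assoc[of \<zero> x z] assms zero_identity zero_closed add_closed by simp
qed (use assms gyr_closed zero_closed in auto)

text \<open>The loop property replaces \<open>gyr (\<ominus> x) x\<close> by
  \<open>gyr (\<ominus> x \<oplus> x) x\<close>, which is \<open>gyr \<zero> x\<close>.\<close>

lemma gyr_neg_left:
  assumes "x \<in> G" "z \<in> G"
  shows "gyr (\<ominus> x) x z = z"
  using gyr_loop[of "\<ominus> x" x z] assms neg_closed neg_inverse gyr_zero_left by simp

lemma left_cancel:
  assumes "x \<in> G" "y \<in> G"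
  shows "\<ominus> x \<oplus> (x \<oplus> y) = y"
  using gyr_assoc[of "\<ominus> x" x y] assms neg_closed neg_inverse gyr_neg_left zero_identity by simp

lemma neg_neg: "x \<in> G \<Longrightarrow> \<ominus> (\<ominus> x) = x"
  using neg_unique[of "\<ominus> x" x] neg_closed neg_inverse by simp

lemma left_cancel':
  assumes "x \<in> G" "y \<in> G"
  shows "x \<oplus> (\<ominus> x \<oplus> y) = y"
  using left_cancel[of "\<ominus> x" y] assms neg_closed neg_neg by simp

lemma neg_zero: "\<ominus> \<zero> = \<zero>"
  using neg_inverse[of \<zero>] zero_identity neg_closed zero_closed by metis

lemma gyr_zero:
  assumes "x \<in> G" "y \<in> G"
  shows "gyr x y \<zero> = \<zero>"
proof (rule left_cancel_inj[of "gyr x y \<zero>"])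
  show "gyr x y \<zero> \<oplus> gyr x y \<zero> = gyr x y \<zero> \<oplus> \<zero>"
    using gyr_hom[of x y \<zero> \<zero>] assms zero_closed zero_identity gyr_closed by simp
qed (use assms gyr_closed zero_closed in auto)

lemma gyr_neg:
  assumes "x \<in> G" "y \<in> G" "z \<in> G"
  shows "gyr x y (\<ominus> z) = \<ominus> gyr x y z"
proof (rule neg_unique)
  show "gyr x y (\<ominus> z) \<oplus> gyr x y z = \<zero>" "gyr x y z \<oplus> gyr x y (\<ominus> z) = \<zero>"
    using gyr_hom[of x y "\<ominus> z" z] gyr_hom[of x y z "\<ominus> z"] assms
      neg_closed neg_inverse gyr_zero by simp_all
qed (use assms gyr_closed neg_closed in auto)

lemma gyr_surj:
  assumes "x \<in> G" "y \<in> G" "z \<in> G"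
  obtains w where "w \<in> G" "gyr x y w = z"
  using gyr_bij[of x y] assms unfolding bij_betw_def by (metis imageE)

lemma right_cancel_gyr:
  assumes "x \<in> G" "v \<in> G"
  shows "(x \<oplus> v) \<oplus> gyr x v (\<ominus> v) = x"
  using gyr_assoc[of x v "\<ominus> v"] assms neg_closed neg_inverse zero_identity by simp

definition gyr_invariant :: "'a set \<Rightarrow> bool" where
  "gyr_invariant V \<longleftrightarrow> V \<subseteq> G \<and> (\<forall>x\<in>G. \<forall>y\<in>G. \<forall>z\<in>G. gyr x y z \<in> V \<longleftrightarrow> z \<in> V)"

lemma gyr_invariantD: "\<lbrakk>gyr_invariant V; x \<in> G; y \<in> G; z \<in> G\<rbrakk> \<Longrightarrow> gyr x y z \<in> V \<longleftrightarrow> z \<in> V"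
  by (auto simp: gyr_invariant_def)

lemma gyr_invariant_image:
  assumes "V \<subseteq> G" "\<And>x y. \<lbrakk>x \<in> G; y \<in> G\<rbrakk> \<Longrightarrow> gyr x y ` V = V"
  shows "gyr_invariant V"
  unfolding gyr_invariant_def
proof (intro conjI ballI iffI assms(1))
  fix x y z assume xyz: "x \<in> G" "y \<in> G" "z \<in> G"
  show "z \<in> V" if "gyr x y z \<in> V"
  proof -
    have "gyr x y z \<in> gyr x y ` V" using assms(2)[OF xyz(1,2)] that by simp
    then obtain w where w: "w \<in> V" "gyr x y z = gyr x y w" by (rule imageE)
    have "inj_on (gyr x y) G" using gyr_bij[OF xyz(1,2)] by (rule bij_betw_imp_inj_on)
    from inj_onD[OF this w(2) xyz(3)] have "z = w" using w(1) assms(1) by blast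
    then show ?thesis using w(1) by simp
  qed
  show "gyr x y z \<in> V" if "z \<in> V" using assms(2)[OF xyz(1,2)] that by blast
qed

definition invariant_subgyrogroup :: "'a set \<Rightarrow> bool" where
  "invariant_subgyrogroup M \<longleftrightarrow> gyr_invariant M \<and> \<zero> \<in> M \<and>
     (\<forall>x\<in>M. \<forall>y\<in>M. x \<oplus> y \<in> M) \<and> (\<forall>x\<in>M. \<ominus> x \<in> M)"

text \<open>The left coset of \<open>M\<close> by \<open>x\<close>, written as a preimage so that
  monotonicity, intersections and closedness can be read off.\<close>

definition coset :: "'a \<Rightarrow> 'a set \<Rightarrow> 'a set" where
  "coset x M = {y \<in> G. \<ominus> x \<oplus> y \<in> M}"

lemma invariant_subgyrogroup_Inter:
  assumes "\<And>M. M \<in> \<M> \<Longrightarrow> invariant_subgyrogroup M" "\<M> \<noteq> {}"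
  shows "invariant_subgyrogroup (\<Inter>\<M>)"
proof -
  obtain M where "M \<in> \<M>" using assms(2) by blast
  then have "\<Inter>\<M> \<subseteq> G"
    using assms(1)[of M] by (auto simp: invariant_subgyrogroup_def gyr_invariant_def)
  moreover have "gyr x y z \<in> \<Inter>\<M> \<longleftrightarrow> z \<in> \<Inter>\<M>" if "x \<in> G" "y \<in> G" "z \<in> G" for x y z
    using assms(1) gyr_invariantD[OF _ that] by (simp add: invariant_subgyrogroup_def)
  ultimately show ?thesis
    using assms(1) by (simp add: invariant_subgyrogroup_def gyr_invariant_def)
qed

lemma subset_carrier: "invariant_subgyrogroup M \<Longrightarrow> M \<subseteq> G"
  by (auto simp: invariant_subgyrogroup_def gyr_invariant_def)

lemma coset_eq_image:
  assumes "x \<in> G" "M \<subseteq> G"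
  shows "coset x M = (\<lambda>m. x \<oplus> m) ` M"
proof
  show "coset x M \<subseteq> (\<lambda>m. x \<oplus> m) ` M"
    using assms left_cancel' by (force simp: coset_def)
  show "(\<lambda>m. x \<oplus> m) ` M \<subseteq> coset x M"
    using assms left_cancel add_closed by (auto simp: coset_def)
qed

lemma coset_zero: "M \<subseteq> G \<Longrightarrow> coset \<zero> M = M"
  using zero_identity by (auto simp: coset_def neg_zero)

lemma coset_refl: "\<lbrakk>x \<in> G; invariant_subgyrogroup M\<rbrakk> \<Longrightarrow> x \<in> coset x M"
  using neg_inverse by (auto simp: coset_def invariant_subgyrogroup_def)

text \<open>Stands in for associativity. With \<open>y = x \<oplus> v\<close> one has
  \<open>x \<oplus> (v \<oplus> w) = y \<oplus> gyr x v w\<close>; choosing \<open>w\<close> as the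
  preimage of \<open>\<ominus> y \<oplus> z\<close> under this gyration keeps it in the invariant
  set \<open>W\<close>.\<close>

lemma diff_trans:
  assumes "gyr_invariant W" "x \<in> G" "y \<in> G" "z \<in> G" "\<ominus> y \<oplus> z \<in> W"
  obtains w where "w \<in> W" "w \<in> G" "\<ominus> x \<oplus> z = (\<ominus> x \<oplus> y) \<oplus> w"
proof -
  define v where "v = \<ominus> x \<oplus> y"
  have v: "v \<in> G" "y = x \<oplus> v" using assms neg_closed add_closed left_cancel' by (auto simp: v_def)
  have u: "\<ominus> y \<oplus> z \<in> G" using assms neg_closed add_closed by auto
  obtain w where w: "w \<in> G" "gyr x v w = \<ominus> y \<oplus> z"
    by (rule gyr_surj[OF assms(2) v(1) u])
  have "z = x \<oplus> (v \<oplus> w)"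
    using gyr_assoc[OF assms(2) v(1) w(1)] left_cancel'[OF assms(3,4)] v(2) w(2) by simp
  then have "\<ominus> x \<oplus> z = v \<oplus> w" using left_cancel assms(2) v w add_closed by simp
  moreover have "w \<in> W" using gyr_invariantD[OF assms(1,2) v(1) w(1)] w(2) assms(5) by simp
  ultimately show thesis using that w(1) by (simp add: v_def)
qed

text \<open>With \<open>v = \<ominus> x \<oplus> y\<close>, right cancellation shows that
  \<open>\<ominus> y \<oplus> x\<close> is a gyration of \<open>\<ominus> v\<close>, and
  \<open>W\<close> is closed under both operations.\<close>

lemma diff_sym:
  assumes "gyr_invariant W" "\<And>w. w \<in> W \<Longrightarrow> \<ominus> w \<in> W" "x \<in> G" "y \<in> G" "\<ominus> x \<oplus> y \<in> W"
  shows "\<ominus> y \<oplus> x \<in> W"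
proof -
  define v where "v = \<ominus> x \<oplus> y"
  have v: "v \<in> G" "y = x \<oplus> v" using assms neg_closed add_closed left_cancel' by (auto simp: v_def)
  have g: "gyr x v (\<ominus> v) \<in> G" using v assms gyr_closed neg_closed by simp
  have "y \<oplus> gyr x v (\<ominus> v) = x" using right_cancel_gyr[OF assms(3) v(1)] v(2) by simp
  then have "\<ominus> y \<oplus> x = gyr x v (\<ominus> v)" using left_cancel[OF assms(4) g] by simp
  then show ?thesis
    using gyr_invariantD[OF assms(1,3) v(1), of "\<ominus> v"] v(1) assms(2,5) neg_closed by (simp add: v_def)
qed

lemma coset_sym:
  assumes "invariant_subgyrogroup M" "x \<in> G" "y \<in> coset x M"
  shows "x \<in> coset y M"
  using diff_sym[of M x y] assms by (auto simp: coset_def invariant_subgyrogroup_def)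

lemma coset_subset:
  assumes M: "invariant_subgyrogroup M" and x: "x \<in> G" and y: "y \<in> coset x M"
  shows "coset y M \<subseteq> coset x M"
proof
  fix z assume z: "z \<in> coset y M"
  obtain w where "w \<in> M" "\<ominus> x \<oplus> z = (\<ominus> x \<oplus> y) \<oplus> w"
    by (rule diff_trans[of M x y z])
      (use M x y z in \<open>auto simp: coset_def invariant_subgyrogroup_def\<close>)
  then show "z \<in> coset x M" using M y z by (auto simp: coset_def invariant_subgyrogroup_def)
qed

lemma coset_eq:
  assumes M: "invariant_subgyrogroup M" and x: "x \<in> G" and y: "y \<in> coset x M"
  shows "coset y M = coset x M"
proof
  have "y \<in> G" using y by (simp add: coset_def)
  from coset_subset[OF M this coset_sym[OF M x y]] show "coset x M \<subseteq> coset y M" .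
  from coset_subset[OF M x y] show "coset y M \<subseteq> coset x M" .
qed

lemma coset_member:
  assumes "invariant_subgyrogroup M" "m \<in> M"
  shows "coset m M = M"
proof -
  have MG: "M \<subseteq> G" using assms(1) by (rule subset_carrier)
  have "m \<in> coset \<zero> M" using assms(2) coset_zero[OF MG] by simp
  from coset_eq[OF assms(1) zero_closed this] show ?thesis using coset_zero[OF MG] by simp
qed

lemma coset_disjoint:
  assumes M: "invariant_subgyrogroup M" and x: "x \<in> G" "x \<notin> M"
  shows "coset x M \<inter> M = {}"
proof (rule ccontr)
  assume "coset x M \<inter> M \<noteq> {}"
  then obtain y where y: "y \<in> coset x M" "y \<in> M" by blast
  have "x \<in> coset y M" using coset_sym[OF M x(1) y(1)] .
  then show False using coset_member[OF M y(2)] x(2) by simp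
qed

lemma coset_mono: "M \<subseteq> N \<Longrightarrow> coset x M \<subseteq> coset x N"
  by (auto simp: coset_def)

lemma coset_Inter: "\<M> \<noteq> {} \<Longrightarrow> coset x (\<Inter>\<M>) = (\<Inter>M\<in>\<M>. coset x M)"
  by (auto simp: coset_def)

end

subsection \<open>Neighbourhoods of the identity\<close>

text \<open>A nonempty finite subfamily of a chain contains its own intersection, so the finite
  intersection property is automatic.\<close>

lemma compactin_chain_Inter:
  assumes "compactin X K" "\<C> \<noteq> {}"
    and closed: "\<And>C. C \<in> \<C> \<Longrightarrow> closedin X C" and meets: "\<And>C. C \<in> \<C> \<Longrightarrow> K \<inter> C \<noteq> {}"
    and chain: "\<And>C D. \<lbrakk>C \<in> \<C>; D \<in> \<C>\<rbrakk> \<Longrightarrow> C \<subseteq> D \<or> D \<subseteq> C"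
  shows "K \<inter> \<Inter>\<C> \<noteq> {}"
proof -
  have "K \<inter> \<Inter>\<F> \<noteq> {}" if "finite \<F>" "\<F> \<subseteq> \<C>" for \<F>
  proof (cases "\<F> = {}")
    case True
    then show ?thesis using assms(2) meets by fastforce
  next
    case False
    have "\<Inter>\<F> \<in> \<F>"
      using that(1) False that(2)
    proof (induction \<F> rule: finite_ne_induct)
      case (insert C \<F>)
      then have "\<Inter>\<F> \<in> \<F>" by simp
      then have "C \<subseteq> \<Inter>\<F> \<or> \<Inter>\<F> \<subseteq> C" using chain[of C "\<Inter>\<F>"] insert.prems by blast
      then have "\<Inter>(insert C \<F>) = C \<or> \<Inter>(insert C \<F>) = \<Inter>\<F>" by auto
      then show ?case using \<open>\<Inter>\<F> \<in> \<F>\<close> by auto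
    qed simp
    then show ?thesis using meets that by blast
  qed
  moreover have "\<forall>\<U>. (\<forall>C\<in>\<U>. closedin X C) \<and>
      (\<forall>\<F>. finite \<F> \<and> \<F> \<subseteq> \<U> \<longrightarrow> K \<inter> \<Inter>\<F> \<noteq> {}) \<longrightarrow> K \<inter> \<Inter>\<U> \<noteq> {}"
    using assms(1) unfolding compactin_fip by (rule conjunct2)
  ultimately show ?thesis using closed by simp
qed

text \<open>Otherwise the closed sets \<open>C - W\<close> form a chain whose members all meet
  \<open>K\<close>, and a common point in \<open>K\<close> would lie outside
  \<open>W\<close>.\<close>

lemma compactin_chain_subset:
  assumes K: "compactin X K" and ne: "\<C> \<noteq> {}"
    and closed: "\<And>C. C \<in> \<C> \<Longrightarrow> closedin X C"
    and chain: "\<And>C D. \<lbrakk>C \<in> \<C>; D \<in> \<C>\<rbrakk> \<Longrightarrow> C \<subseteq> D \<or> D \<subseteq> C"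
    and W: "openin X W" "K \<inter> \<Inter>\<C> \<subseteq> W"
  shows "\<exists>C\<in>\<C>. K \<inter> C \<subseteq> W"
proof (rule ccontr)
  assume no: "\<not> (\<exists>C\<in>\<C>. K \<inter> C \<subseteq> W)"
  have "K \<inter> \<Inter>((\<lambda>C. C - W) ` \<C>) \<noteq> {}"
  proof (rule compactin_chain_Inter[OF K])
    show "(\<lambda>C. C - W) ` \<C> \<noteq> {}" using ne by simp
    show "closedin X C" if C: "C \<in> (\<lambda>C. C - W) ` \<C>" for C
    proof -
      obtain D where "D \<in> \<C>" "C = D - W" using C by blast
      then show ?thesis using closed W(1) closedin_diff by blast
    qed
    show "K \<inter> C \<noteq> {}" if "C \<in> (\<lambda>C. C - W) ` \<C>" for C
      using that no by blast
    show "C \<subseteq> D \<or> D \<subseteq> C" if CD: "C \<in> (\<lambda>C. C - W) ` \<C>" "D \<in> (\<lambda>C. C - W) ` \<C>" for C D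
    proof -
      obtain C' D' where "C' \<in> \<C>" "D' \<in> \<C>" "C = C' - W" "D = D' - W" using CD by blast
      then show ?thesis using chain[of C' D'] by blast
    qed
  qed
  then show False using W(2) ne by blast
qed

lemma compactin_decseq_subset:
  fixes F :: "nat \<Rightarrow> 'a set"
  assumes "compactin X K" "\<And>n. closedin X (F n)" "decseq F" "openin X W" "K \<inter> (\<Inter>n. F n) \<subseteq> W"
  obtains n where "K \<inter> F n \<subseteq> W"
proof -
  have "F m \<subseteq> F n \<or> F n \<subseteq> F m" for m n
    using assms(3) nat_le_linear[of m n] by (auto simp: decseq_def)
  then have "\<exists>C\<in>range F. K \<inter> C \<subseteq> W"
    using assms by (intro compactin_chain_subset[of X K "range F" W]) auto
  then show thesis using that by blast
qed

section \<open>Chains of invariant neighbourhoods, their intersections and the metrization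
  criterion\<close>

context topological_gyrogroup
begin

abbreviation "G \<equiv> topspace X"

lemma continuous_map_add:
  assumes "continuous_map Z X f" "continuous_map Z X g"
  shows "continuous_map Z X (\<lambda>z. f z \<oplus> g z)"
proof -
  have "continuous_map Z (prod_topology X X) (\<lambda>z. (f z, g z))"
    using assms by (rule continuous_map_pairedI)
  from continuous_map_compose[OF this continuous_add] show ?thesis by (simp add: comp_def)
qed

lemma continuous_map_left_add: "a \<in> G \<Longrightarrow> continuous_map X X (\<lambda>y. a \<oplus> y)"
  by (intro continuous_map_add) auto

lemma closedin_coset:
  assumes "closedin X M" "x \<in> G"
  shows "closedin X (coset x M)"
  using closedin_continuous_map_preimage[OF continuous_map_left_add[of "\<ominus> x"] assms(1)] assms(2)
    neg_closed by (simp add: coset_def)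

abbreviation nbhd where "nbhd \<equiv> neighborhood_of X \<zero>"

lemma nbhd_zero: "nbhd N \<Longrightarrow> \<zero> \<in> N"
  by (auto simp: neighborhood_of_def)

lemma nbhd_subset: "nbhd N \<Longrightarrow> N \<subseteq> G"
  by (auto simp: neighborhood_of_def)

lemma nbhd_Int: "nbhd M \<Longrightarrow> nbhd N \<Longrightarrow> nbhd (M \<inter> N)"
  unfolding neighborhood_of_def by (meson IntI Int_mono le_infI1 openin_Int)

lemma nbhd_open: "openin X W \<Longrightarrow> \<zero> \<in> W \<Longrightarrow> nbhd W"
  using openin_subset by (auto simp: neighborhood_of_def)

lemma nbhd_mono: "nbhd M \<Longrightarrow> M \<subseteq> N \<Longrightarrow> N \<subseteq> G \<Longrightarrow> nbhd N"
  unfolding neighborhood_of_def by blast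

text \<open>The relations \<open>\<ominus> x \<oplus> y \<in> V n\<close> are the entourages of a left uniformity; gyration invariance
  makes them symmetric and gives \<open>V (Suc n)\<close> as a half of \<open>V n\<close>.\<close>

definition gyr_chain :: "(nat \<Rightarrow> 'a set) \<Rightarrow> bool" where
  "gyr_chain V \<longleftrightarrow> (\<forall>n. nbhd (V n) \<and> gyr_invariant (V n) \<and> (\<forall>x\<in>V n. \<ominus> x \<in> V n) \<and>
     (\<forall>x\<in>V (Suc n). \<forall>y\<in>V (Suc n). x \<oplus> y \<in> V n))"

context
  fixes V assumes V: "gyr_chain V"
begin

lemma chain_nbhd: "nbhd (V n)" and chain_invariant: "gyr_invariant (V n)"
  and chain_neg: "x \<in> V n \<Longrightarrow> \<ominus> x \<in> V n"
  and chain_add: "x \<in> V (Suc n) \<Longrightarrow> y \<in> V (Suc n) \<Longrightarrow> x \<oplus> y \<in> V n"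
  using V by (auto simp: gyr_chain_def)

lemma chain_subset: "V n \<subseteq> G"
  using chain_nbhd nbhd_subset by blast

lemma chain_zero: "\<zero> \<in> V n"
  using chain_nbhd nbhd_zero by blast

lemma chain_decseq: "decseq V"
proof (rule decseq_SucI)
  fix n show "V (Suc n) \<subseteq> V n"
  proof
    fix x assume "x \<in> V (Suc n)"
    then show "x \<in> V n"
      using chain_add[OF _ chain_zero] zero_identity[OF subsetD[OF chain_subset]] by force
  qed
qed

text \<open>A closure point \<open>x\<close> has a neighbourhood, a left translate, that contains
  some \<open>y\<close> in \<open>V (Suc n)\<close> with \<open>\<ominus> x \<oplus> y\<close> in
  \<open>V (Suc n)\<close>. By symmetry \<open>x = y \<oplus> (\<ominus> y \<oplus> x)\<close> is a
  sum of two elements of \<open>V (Suc n)\<close>.\<close>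

lemma chain_closure: "X closure_of (V (Suc n)) \<subseteq> V n"
proof
  fix x assume x: "x \<in> X closure_of (V (Suc n))"
  then have xG: "x \<in> G" by (simp add: in_closure_of)
  obtain W where W: "openin X W" "\<zero> \<in> W" "W \<subseteq> V (Suc n)"
    using chain_nbhd[of "Suc n"] by (auto simp: neighborhood_of_def)
  let ?O = "{y \<in> G. \<ominus> x \<oplus> y \<in> W}"
  have "openin X ?O"
    using openin_continuous_map_preimage[OF continuous_map_left_add[of "\<ominus> x"] W(1)] xG neg_closed by simp
  moreover have "x \<in> ?O" using xG W neg_inverse by simp
  ultimately have "\<exists>y. y \<in> V (Suc n) \<and> y \<in> ?O" using x in_closure_of[of x X] by metis
  then obtain y where y: "y \<in> V (Suc n)" "y \<in> G" "\<ominus> x \<oplus> y \<in> V (Suc n)" using W(3) by blast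
  then have "\<ominus> y \<oplus> x \<in> V (Suc n)"
    by (intro diff_sym[OF chain_invariant chain_neg xG])
  with y(1) have "y \<oplus> (\<ominus> y \<oplus> x) \<in> V n" by (rule chain_add)
  then show "x \<in> V n" using left_cancel' y xG by simp
qed

lemma chain_Inter_closure: "(\<Inter>n. X closure_of (V n)) = (\<Inter>n. V n)"
proof
  show "(\<Inter>n. X closure_of (V n)) \<subseteq> (\<Inter>n. V n)"
    using chain_closure by (intro INF_mono) blast
  show "(\<Inter>n. V n) \<subseteq> (\<Inter>n. X closure_of (V n))"
    using closure_of_subset[OF chain_subset] by (intro INF_mono) blast
qed

lemma chain_Inter_closed: "closedin X (\<Inter>n. V n)"
proof -
  have "closedin X (\<Inter>n. X closure_of (V n))" by (rule closedin_INT) auto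
  then show ?thesis unfolding chain_Inter_closure .
qed

lemma chain_subgroup: "invariant_subgyrogroup (\<Inter>n. V n)"
proof -
  have "gyr x y z \<in> (\<Inter>n. V n) \<longleftrightarrow> z \<in> (\<Inter>n. V n)" if "x \<in> G" "y \<in> G" "z \<in> G" for x y z
    using gyr_invariantD[OF chain_invariant that] by simp
  then show ?thesis
    using chain_zero chain_add chain_neg subsetD[OF chain_subset]
    by (auto simp: invariant_subgyrogroup_def gyr_invariant_def)
qed

lemma chain_diff_trans:
  assumes "x \<in> G" "y \<in> G" "z \<in> G" "\<ominus> x \<oplus> y \<in> V (Suc n)" "\<ominus> y \<oplus> z \<in> V (Suc n)"
  shows "\<ominus> x \<oplus> z \<in> V n"
proof -
  obtain w where "w \<in> V (Suc n)" "\<ominus> x \<oplus> z = (\<ominus> x \<oplus> y) \<oplus> w"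
    by (rule diff_trans[OF chain_invariant assms(1-3,5)])
  then show ?thesis using chain_add assms(4) by simp
qed

text \<open>Left translations carry the base at \<open>\<zero>\<close> to every point, so the
  entourages induce the given topology; Hausdorffness separates points.\<close>

lemma metrizable_if_chain_base:
  assumes haus: "Hausdorff_space X"
    and base: "\<And>W. openin X W \<Longrightarrow> \<zero> \<in> W \<Longrightarrow> \<exists>n. V n \<subseteq> W"
  shows "metrizable_space X"
\<comment> \<open>One step of the chain absorbs one composition. A threefold composition takes two
  steps, hence the even indices.\<close>
proof (rule metrizable_space_countable_entourages[where E = "\<lambda>n x y. \<ominus> x \<oplus> y \<in> V (2 * n)"])
  have mem: "\<And>n. v \<in> V (Suc n) \<Longrightarrow> v \<in> V n" for v
    using chain_decseq by (auto simp: decseq_Suc_iff)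
  show "\<ominus> x \<oplus> x \<in> V (2 * n)" if "x \<in> G" for n x
    using that neg_inverse chain_zero by simp
  show "\<ominus> y \<oplus> x \<in> V (2 * n)" if "x \<in> G" "y \<in> G" "\<ominus> x \<oplus> y \<in> V (2 * n)" for n x y
    using that diff_sym[OF chain_invariant] chain_neg by blast
  show "\<ominus> x \<oplus> w \<in> V (2 * n)"
    if "x \<in> G" "y \<in> G" "z \<in> G" "w \<in> G" "\<ominus> x \<oplus> y \<in> V (2 * Suc n)"
      "\<ominus> y \<oplus> z \<in> V (2 * Suc n)" "\<ominus> z \<oplus> w \<in> V (2 * Suc n)" for n x y z w
  proof (rule chain_diff_trans[of x z w])
    show "\<ominus> x \<oplus> z \<in> V (Suc (2 * n))"
      using chain_diff_trans[of x y z "Suc (2 * n)"] that by simp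
    show "\<ominus> z \<oplus> w \<in> V (Suc (2 * n))" using that(7) mem by simp
  qed (use that in auto)
  show "x = y" if "x \<in> G" "y \<in> G" "\<And>n. \<ominus> x \<oplus> y \<in> V (2 * n)" for x y
  proof -
    have v: "\<ominus> x \<oplus> y \<in> G" using that neg_closed add_closed by simp
    have "\<ominus> x \<oplus> y = \<zero>"
    proof (rule ccontr)
      assume "\<ominus> x \<oplus> y \<noteq> \<zero>"
      moreover have "openin X (G - {\<ominus> x \<oplus> y})"
        using closedin_Hausdorff_singleton[OF haus v] by blast
      ultimately obtain n where "V n \<subseteq> G - {\<ominus> x \<oplus> y}"
        using base[of "G - {\<ominus> x \<oplus> y}"] zero_closed by auto
      moreover have "V (2 * n) \<subseteq> V n" using chain_decseq by (simp add: decseq_def)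
      ultimately show False using that(3)[of n] by blast
    qed
    then show ?thesis using left_cancel'[OF that(1,2)] zero_identity[OF that(1)] by simp
  qed
  show "openin X U \<longleftrightarrow> U \<subseteq> G \<and> (\<forall>x\<in>U. \<exists>n. \<forall>y\<in>G. \<ominus> x \<oplus> y \<in> V (2 * n) \<longrightarrow> y \<in> U)" for U
  proof (intro iffI conjI ballI)
    assume U: "openin X U"
    then show "U \<subseteq> G" by (rule openin_subset)
    fix x assume x: "x \<in> U"
    then have xG: "x \<in> G" using \<open>U \<subseteq> G\<close> by blast
    have "openin X {v \<in> G. x \<oplus> v \<in> U}"
      by (rule openin_continuous_map_preimage[OF continuous_map_left_add[OF xG] U])
    moreover have "\<zero> \<in> {v \<in> G. x \<oplus> v \<in> U}" using x xG zero_identity zero_closed by simp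
    ultimately obtain n where n: "V n \<subseteq> {v \<in> G. x \<oplus> v \<in> U}" using base by blast
    have "y \<in> U" if "y \<in> G" "\<ominus> x \<oplus> y \<in> V (2 * n)" for y
    proof -
      have "V (2 * n) \<subseteq> V n" using chain_decseq by (simp add: decseq_def)
      then have "x \<oplus> (\<ominus> x \<oplus> y) \<in> U" using n that(2) by blast
      then show ?thesis using left_cancel'[OF xG that(1)] by simp
    qed
    then show "\<exists>n. \<forall>y\<in>G. \<ominus> x \<oplus> y \<in> V (2 * n) \<longrightarrow> y \<in> U" by blast
  next
    assume R: "U \<subseteq> G \<and> (\<forall>x\<in>U. \<exists>n. \<forall>y\<in>G. \<ominus> x \<oplus> y \<in> V (2 * n) \<longrightarrow> y \<in> U)"
    show "openin X U"
    proof (subst openin_subopen, intro ballI)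
      fix x assume x: "x \<in> U"
      then have xG: "x \<in> G" using R by blast
      obtain n where n: "\<forall>y\<in>G. \<ominus> x \<oplus> y \<in> V (2 * n) \<longrightarrow> y \<in> U" using R x by blast
      obtain W where W: "openin X W" "\<zero> \<in> W" "W \<subseteq> V (2 * n)"
        using chain_nbhd[of "2 * n"] by (auto simp: neighborhood_of_def)
      have "openin X {y \<in> G. \<ominus> x \<oplus> y \<in> W}"
        using openin_continuous_map_preimage[OF continuous_map_left_add[of "\<ominus> x"] W(1)] xG neg_closed
        by simp
      moreover have "x \<in> {y \<in> G. \<ominus> x \<oplus> y \<in> W}" using xG W neg_inverse by simp
      moreover have "{y \<in> G. \<ominus> x \<oplus> y \<in> W} \<subseteq> U" using W n by blast
      ultimately show "\<exists>T. openin X T \<and> x \<in> T \<and> T \<subseteq> U" by blast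
    qed
  qed
qed

text \<open>The sets \<open>B n\<close> shrink to \<open>K\<close>, so the intersection of the chain
  is a closed subset of \<open>K\<close>. The second claim says that the chain is an outer
  neighbourhood base of its intersection: countable character controls it outside \<open>K\<close>,
  compactness inside \<open>K\<close>.\<close>

lemma chain_outer_base:
  assumes haus: "Hausdorff_space X" and K: "compactin X K"
    and B: "\<And>n. openin X (B n)" "\<And>n. K \<subseteq> B n"
      "\<And>W. openin X W \<Longrightarrow> K \<subseteq> W \<Longrightarrow> \<exists>n. B n \<subseteq> W"
    and VB: "\<And>n. V n \<subseteq> B n"
  shows "compactin X (\<Inter>n. V n)"
    and "\<And>W. openin X W \<Longrightarrow> (\<Inter>n. V n) \<subseteq> W \<Longrightarrow> \<exists>n. V n \<subseteq> W"
proof -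
  have "(\<Inter>n. V n) \<subseteq> K"
  proof
    fix x assume x: "x \<in> (\<Inter>n. V n)"
    show "x \<in> K"
    proof (rule ccontr)
      assume "x \<notin> K"
      have "x \<in> G" using x subsetD[OF chain_subset[of 0]] by simp
      then have "openin X (G - {x})" using closedin_Hausdorff_singleton[OF haus] by blast
      moreover have "K \<subseteq> G - {x}" using \<open>x \<notin> K\<close> compactin_subset_topspace[OF K] by blast
      ultimately obtain n where "B n \<subseteq> G - {x}" using B(3)[of "G - {x}"] by blast
      then show False using VB[of n] x by blast
    qed
  qed
  then show "compactin X (\<Inter>n. V n)" by (rule closed_compactin[OF K _ chain_Inter_closed])
  fix W assume W: "openin X W" "(\<Inter>n. V n) \<subseteq> W"
  have "decseq (\<lambda>n. X closure_of (V n))"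
    unfolding decseq_def by (intro allI impI closure_of_mono decseqD[OF chain_decseq])
  moreover have "K \<inter> (\<Inter>n. X closure_of (V n)) \<subseteq> W"
    unfolding chain_Inter_closure using W(2) by blast
  ultimately obtain n where n: "K \<inter> X closure_of (V n) \<subseteq> W"
    using compactin_decseq_subset[OF K closedin_closure_of _ W(1)] by metis
  \<comment> \<open>Points of \<open>K\<close> outside \<open>W\<close> avoid the closure of
    \<open>V n\<close>, so this open set contains \<open>K\<close> and therefore some
    \<open>B m\<close>. Beyond both indices the chain lies in \<open>B m\<close> and in the closure
    of \<open>V n\<close>, hence in \<open>W\<close>.\<close>
  have "openin X (W \<union> (G - X closure_of (V n)))"
    by (intro openin_Un W(1) openin_diff openin_topspace closedin_closure_of)
  moreover have "K \<subseteq> W \<union> (G - X closure_of (V n))"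
    using n compactin_subset_topspace[OF K] by blast
  ultimately obtain m where "B m \<subseteq> W \<union> (G - X closure_of (V n))" using B(3) by blast
  moreover have "V (max m n) \<subseteq> B m" "V (max m n) \<subseteq> V n"
    using decseqD[OF chain_decseq, of m "max m n"] decseqD[OF chain_decseq, of n "max m n"] VB[of m]
    by auto
  moreover have "V n \<subseteq> X closure_of (V n)" using closure_of_subset[OF chain_subset] .
  ultimately have "V (max m n) \<subseteq> W" by blast
  then show "\<exists>n. V n \<subseteq> W" by blast
qed

end

end

section \<open>Existence of invariant symmetric neighbourhoods and of chains of them\<close>

context strongly_topological_gyrogroup
begin

text \<open>Continuity of addition at \<open>(\<zero>, \<zero>)\<close> and the invariant base give
  a gyration-invariant \<open>U\<close> whose sums stay in \<open>N\<close>. Cutting it down to the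
  points whose inverse is also in \<open>U\<close> preserves invariance, since gyrations commute
  with inversion.\<close>

lemma invariant_nbhd_exists:
  assumes "nbhd N"
  shows "\<exists>W. nbhd W \<and> gyr_invariant W \<and> (\<forall>x\<in>W. \<ominus> x \<in> W) \<and> W \<subseteq> N \<and>
    (\<forall>x\<in>W. \<forall>y\<in>W. x \<oplus> y \<in> N)"
proof -
  obtain \<U> where U: "neighborhood_base_family X \<zero> \<U>"
    "\<forall>U\<in>\<U>. \<forall>x\<in>G. \<forall>y\<in>G. gyr x y ` U = U"
    using gyr_invariant_base by (elim exE conjE)
  obtain O' where O: "openin X O'" "\<zero> \<in> O'" "O' \<subseteq> N" using assms by (auto simp: neighborhood_of_def)
  define S where "S = {p \<in> topspace (prod_topology X X). (\<lambda>(x, y). x \<oplus> y) p \<in> O'}"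
  have "openin (prod_topology X X) S"
    unfolding S_def by (rule openin_continuous_map_preimage[OF continuous_add O(1)])
  moreover have "(\<zero>, \<zero>) \<in> S"
    using O zero_closed zero_identity by (simp add: S_def)
  ultimately obtain A B where AB: "openin X A" "openin X B" "\<zero> \<in> A" "\<zero> \<in> B" "A \<times> B \<subseteq> S"
    unfolding openin_prod_topology_alt by meson
  have "nbhd (A \<inter> B \<inter> N)"
    using nbhd_Int[OF nbhd_Int[OF nbhd_open nbhd_open] assms] AB by simp
  moreover have base: "\<forall>U\<in>\<U>. nbhd U" "\<forall>N. nbhd N \<longrightarrow> (\<exists>U\<in>\<U>. U \<subseteq> N)"
    using U(1) by (simp_all add: neighborhood_base_family_def)
  ultimately obtain U where "U \<in> \<U>" and UABN: "U \<subseteq> A \<inter> B \<inter> N" by metis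
  have nU: "nbhd U" using base(1) \<open>U \<in> \<U>\<close> by blast
  have inv: "gyr_invariant U"
    by (rule gyr_invariant_image[OF nbhd_subset[OF nU]]) (use U(2) \<open>U \<in> \<U>\<close> in simp)
  define W where "W = {x \<in> U. \<ominus> x \<in> U}"
  have UG: "U \<subseteq> G" using nbhd_subset[OF nU] .
  have "nbhd W"
  proof -
    obtain T where T: "openin X T" "\<zero> \<in> T" "T \<subseteq> U" using nU by (auto simp: neighborhood_of_def)
    have "openin X {x \<in> G. \<ominus> x \<in> T}" by (rule openin_continuous_map_preimage[OF continuous_neg T(1)])
    then have "nbhd (T \<inter> {x \<in> G. \<ominus> x \<in> T})"
      using T neg_zero zero_closed by (intro nbhd_open openin_Int) auto
    then show ?thesis using T(3) UG by (rule_tac nbhd_mono) (auto simp: W_def)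
  qed
  moreover have "gyr_invariant W"
  proof -
    have "gyr x y z \<in> W \<longleftrightarrow> z \<in> W" if "x \<in> G" "y \<in> G" "z \<in> G" for x y z
      using gyr_invariantD[OF inv that] gyr_invariantD[OF inv that(1,2) neg_closed[OF that(3)]]
        gyr_neg[OF that] by (simp add: W_def)
    then show ?thesis using UG by (auto simp: gyr_invariant_def W_def)
  qed
  moreover have "\<forall>x\<in>W. \<ominus> x \<in> W" using UG neg_neg by (auto simp: W_def)
  moreover have "x \<oplus> y \<in> N" if "x \<in> W" "y \<in> W" for x y
  proof -
    have "(x, y) \<in> A \<times> B" using that UABN by (auto simp: W_def)
    then have "(x, y) \<in> S" using AB(5) by blast
    then show ?thesis using O(3) by (auto simp: S_def)
  qed
  moreover have "W \<subseteq> N" using UABN by (auto simp: W_def)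
  ultimately show ?thesis by blast
qed

text \<open>Dependent choice: each set is a half of the previous one intersected with the next
  prescribed neighbourhood.\<close>

lemma gyr_chain_exists:
  assumes U: "\<And>n. nbhd (U n)"
  obtains V where "gyr_chain V" "\<And>n. V n \<subseteq> U n"
proof -
  define P where "P n W \<longleftrightarrow> nbhd W \<and> gyr_invariant W \<and> (\<forall>x\<in>W. \<ominus> x \<in> W) \<and> W \<subseteq> U n" for n W
  have "\<exists>V. \<forall>n. P n (V n) \<and> (\<forall>x\<in>V (Suc n). \<forall>y\<in>V (Suc n). x \<oplus> y \<in> V n)"
  proof (rule dependent_nat_choice)
    show "\<exists>W. P 0 W" using invariant_nbhd_exists[OF U[of 0]] by (auto simp: P_def)
    fix W n assume "P n W"
    then have "nbhd (W \<inter> U (Suc n))" using U nbhd_Int by (simp add: P_def)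
    then obtain W' where "nbhd W'" "gyr_invariant W'" "\<forall>x\<in>W'. \<ominus> x \<in> W'" "W' \<subseteq> W \<inter> U (Suc n)"
      and W': "\<forall>x\<in>W'. \<forall>y\<in>W'. x \<oplus> y \<in> W \<inter> U (Suc n)"
      using invariant_nbhd_exists by metis
    then have "P (Suc n) W'" by (simp add: P_def)
    moreover have "\<forall>x\<in>W'. \<forall>y\<in>W'. x \<oplus> y \<in> W" using W' by simp
    ultimately show "\<exists>W'. P (Suc n) W' \<and> (\<forall>x\<in>W'. \<forall>y\<in>W'. x \<oplus> y \<in> W)" by blast
  qed
  then obtain V where V: "\<forall>n. P n (V n) \<and> (\<forall>x\<in>V (Suc n). \<forall>y\<in>V (Suc n). x \<oplus> y \<in> V n)" by (rule exE)
  show thesis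
  proof (rule that)
    show "gyr_chain V" using V by (simp add: P_def gyr_chain_def)
    show "V n \<subseteq> U n" for n using V by (simp add: P_def)
  qed
qed

end

subsection \<open>Families of cosets converging to a subgyrogroup\<close>

context topological_gyrogroup
begin

text \<open>Only neighbourhoods of \<open>\<zero>\<close> enter, so such a set need not be a
  G-delta. The family is nonempty to keep \<open>\<Inter>{}\<close>, the whole type, out.\<close>

definition nbhd_gdelta :: "'a set \<Rightarrow> bool" where
  "nbhd_gdelta M \<longleftrightarrow> (\<exists>\<U>. countable \<U> \<and> \<U> \<noteq> {} \<and> (\<forall>U\<in>\<U>. nbhd U) \<and> M = \<Inter>\<U>)"

lemma nbhd_gdelta_Inter:
  assumes "countable \<M>" "\<M> \<noteq> {}" and "\<And>M. M \<in> \<M> \<Longrightarrow> nbhd_gdelta M"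
  shows "nbhd_gdelta (\<Inter>\<M>)"
proof -
  have "\<forall>M\<in>\<M>. \<exists>\<U>. countable \<U> \<and> \<U> \<noteq> {} \<and> (\<forall>U\<in>\<U>. nbhd U) \<and> M = \<Inter>\<U>"
    using assms(3) by (simp add: nbhd_gdelta_def)
  then obtain u where u: "\<forall>M\<in>\<M>. countable (u M) \<and> u M \<noteq> {} \<and> (\<forall>U\<in>u M. nbhd U) \<and> M = \<Inter>(u M)"
    by (rule bchoice[THEN exE])
  then have u': "\<And>M. M \<in> \<M> \<Longrightarrow> countable (u M)" "\<And>M. M \<in> \<M> \<Longrightarrow> u M \<noteq> {}"
    "\<And>M. M \<in> \<M> \<Longrightarrow> \<forall>U\<in>u M. nbhd U" and M: "\<And>M. M \<in> \<M> \<Longrightarrow> \<Inter>(u M) = M"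
    by (blast, blast, blast, metis)
  have "countable (\<Union>(u ` \<M>))" using assms(1) u'(1) by (rule countable_UN)
  moreover have "\<Union>(u ` \<M>) \<noteq> {}" using assms(2) u'(2) by simp
  moreover have "\<forall>U\<in>\<Union>(u ` \<M>). nbhd U" using u'(3) by simp
  moreover have "\<Inter>\<M> = \<Inter>(\<Union>(u ` \<M>))"
  proof -
    have "\<Inter>(\<Union>(u ` \<M>)) = (\<Inter>M\<in>\<M>. \<Inter>(u M))" by blast
    also have "\<dots> = (\<Inter>M\<in>\<M>. M)" using M by (intro INF_cong) simp_all
    finally show ?thesis by simp
  qed
  ultimately show ?thesis unfolding nbhd_gdelta_def by blast
qed

lemma chain_gdelta:
  assumes "gyr_chain V"
  shows "nbhd_gdelta (\<Inter>n. V n)"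
  unfolding nbhd_gdelta_def
proof (intro exI conjI)
  show "\<forall>U\<in>range V. nbhd U" using chain_nbhd[OF assms] by simp
qed simp_all

text \<open>A stage is an approximation to an uncountable family converging to \<zero>: a family of cosets of M,
  indexed by sets L, which converges to M. Indices L with c L = {} are unused. A coset is indexed by the
  subgyrogroup of the stage at which it was introduced, which makes all the indices along a chain of
  stages distinct.\<close>

definition stage :: "'a set \<Rightarrow> 'a set \<Rightarrow> ('a set \<Rightarrow> 'a set) \<Rightarrow> bool" where
  "stage H M c \<longleftrightarrow> invariant_subgyrogroup M \<and> closedin X M \<and> M \<subseteq> H \<and>
     (\<forall>L. c L \<noteq> {} \<longrightarrow> (\<exists>x\<in>topspace X. c L = coset x M)) \<and>
     (\<forall>L. c L \<subseteq> L \<inter> H - M) \<and>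
     (\<forall>W. openin X W \<longrightarrow> M \<subseteq> W \<longrightarrow> finite {L. \<not> c L \<subseteq> W}) \<and>
     (countable {L. c L \<noteq> {}} \<longrightarrow> nbhd_gdelta M)"

text \<open>The first clause says that the label \<open>M\<close> has come into use, which makes the
  relation irreflexive on stages. The last one forces cosets introduced later to lie inside
  \<open>M\<close>, since a coset lies inside its label; this is what preserves convergence at
  limits.\<close>

definition finer :: "'a set \<Rightarrow> ('a set \<Rightarrow> 'a set) \<Rightarrow> 'a set \<Rightarrow> ('a set \<Rightarrow> 'a set) \<Rightarrow> bool" where
  "finer M' c' M c \<longleftrightarrow> c' M \<noteq> {} \<and> M' \<subseteq> M \<and>
     (\<forall>L. c L \<noteq> {} \<longrightarrow> c' L \<noteq> {} \<and> c' L \<subseteq> c L) \<and>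
     (\<forall>L. c L = {} \<longrightarrow> c' L \<noteq> {} \<longrightarrow> L \<subseteq> M)"

lemma stageD:
  assumes "stage H M c"
  shows "invariant_subgyrogroup M" "closedin X M" "M \<subseteq> H"
    "\<And>L. c L \<noteq> {} \<Longrightarrow> \<exists>x\<in>topspace X. c L = coset x M"
    "\<And>L. c L \<subseteq> L" "\<And>L. c L \<subseteq> H" "\<And>L. c L \<inter> M = {}"
    "\<And>W. openin X W \<Longrightarrow> M \<subseteq> W \<Longrightarrow> finite {L. \<not> c L \<subseteq> W}"
    "countable {L. c L \<noteq> {}} \<Longrightarrow> nbhd_gdelta M"
proof -
  show "c L \<subseteq> L" "c L \<subseteq> H" "c L \<inter> M = {}" for L
  proof -
    have "c L \<subseteq> L \<inter> H - M" using assms by (simp add: stage_def)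
    then show "c L \<subseteq> L" "c L \<subseteq> H" "c L \<inter> M = {}" by blast+
  qed
qed (use assms in \<open>simp_all add: stage_def\<close>)

lemma stage_coset:
  assumes "stage H M c" "x \<in> c L"
  shows "c L = coset x M" "x \<in> topspace X"
proof -
  obtain y where y: "y \<in> topspace X" "c L = coset y M"
    using stageD(4)[OF assms(1), of L] assms(2) by blast
  then show "c L = coset x M" using coset_eq[OF stageD(1)[OF assms(1)] y(1)] assms(2) by simp
  show "x \<in> topspace X" using y assms(2) by (simp add: coset_def)
qed

lemma stage_closed:
  assumes "stage H M c"
  shows "closedin X (c L)"
proof (cases "c L = {}")
  case False
  then obtain y where "y \<in> topspace X" "c L = coset y M" using stageD(4)[OF assms] by blast
  then show ?thesis using closedin_coset stageD(2)[OF assms] by simp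
qed simp

lemma finerD:
  assumes "finer M' c' M c"
  shows "c' M \<noteq> {}" "M' \<subseteq> M" "\<And>L. c L \<noteq> {} \<Longrightarrow> c' L \<noteq> {}" "\<And>L. c L \<noteq> {} \<Longrightarrow> c' L \<subseteq> c L"
    "\<And>L. c L = {} \<Longrightarrow> c' L \<noteq> {} \<Longrightarrow> L \<subseteq> M"
  using assms unfolding finer_def by simp_all

lemma finer_trans:
  assumes "finer M3 c3 M2 c2" "finer M2 c2 M1 c1"
  shows "finer M3 c3 M1 c1"
  unfolding finer_def
proof (intro conjI allI impI)
  show "c3 M1 \<noteq> {}" using finerD(1)[OF assms(2)] finerD(3)[OF assms(1)] by simp
  show "M3 \<subseteq> M1" using finerD(2)[OF assms(2)] finerD(2)[OF assms(1)] by simp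
  fix L
  show "c3 L \<noteq> {}" "c3 L \<subseteq> c1 L" if "c1 L \<noteq> {}"
    using finerD(3)[OF assms(2) that] finerD(4)[OF assms(2) that] finerD(3,4)[OF assms(1), of L]
    by blast+
  show "L \<subseteq> M1" if "c1 L = {}" "c3 L \<noteq> {}"
  proof (cases "c2 L = {}")
    case True
    then show ?thesis using finerD(5)[OF assms(1) True that(2)] finerD(2)[OF assms(2)] by simp
  next
    case False
    then show ?thesis using finerD(5)[OF assms(2) that(1)] by simp
  qed
qed

text \<open>A coset labelled \<open>M\<close> would be both inside \<open>M\<close> and disjoint
  from it. So the current subgyrogroup is always a free label for the next coset.\<close>

lemma stage_label_fresh: "stage H M c \<Longrightarrow> c M = {}"
  using stageD(5)[of H M c M] stageD(7)[of H M c M] by blast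

text \<open>Cosets close to \<open>M\<close> have representatives close to \<open>\<zero>\<close>.
  For \<open>y\<close> near \<open>m\<close> in \<open>M\<close>, the point
  \<open>m \<oplus> ((\<ominus> m \<oplus> y) \<oplus> \<ominus> m)\<close> is near
  \<open>\<zero>\<close>; it equals \<open>y\<close> plus a gyration of \<open>\<ominus> m\<close>,
  hence lies in \<open>coset y M\<close> by invariance.\<close>

lemma coset_meets_nbhd:
  assumes M: "invariant_subgyrogroup M" and N: "nbhd N"
  obtains W where "openin X W" "M \<subseteq> W" "\<And>y. y \<in> W \<Longrightarrow> coset y M \<inter> N \<noteq> {}"
proof -
  obtain T where T: "openin X T" "\<zero> \<in> T" "T \<subseteq> N" using N by (auto simp: neighborhood_of_def)
  have MG: "M \<subseteq> topspace X" using M by (rule subset_carrier)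
  define O' where "O' m = {y \<in> topspace X. m \<oplus> ((\<ominus> m \<oplus> y) \<oplus> \<ominus> m) \<in> T}" for m
  have "openin X (O' m)" if "m \<in> M" for m
  proof -
    have m: "m \<in> topspace X" "\<ominus> m \<in> topspace X" using that MG neg_closed by auto
    have "continuous_map X X (\<lambda>y. m \<oplus> ((\<ominus> m \<oplus> y) \<oplus> \<ominus> m))"
      using m by (intro continuous_map_add) simp_all
    then show ?thesis unfolding O'_def using T(1) by (rule openin_continuous_map_preimage)
  qed
  then have "openin X (\<Union>m\<in>M. O' m)" by blast
  moreover have "m \<in> O' m" if "m \<in> M" for m
  proof -
    have "m \<in> topspace X" using that MG by blast
    then show ?thesis using neg_inverse[of m] zero_identity[of "\<ominus> m"] neg_closed[of m] T(2)
      by (simp add: O'_def)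
  qed
  then have "M \<subseteq> (\<Union>m\<in>M. O' m)" by blast
  moreover have "coset y M \<inter> N \<noteq> {}" if "y \<in> (\<Union>m\<in>M. O' m)" for y
  proof -
    obtain m where m: "m \<in> M" "y \<in> topspace X" "m \<oplus> ((\<ominus> m \<oplus> y) \<oplus> \<ominus> m) \<in> T"
      using \<open>y \<in> (\<Union>m\<in>M. O' m)\<close> by (auto simp: O'_def)
    have mG: "m \<in> topspace X" "\<ominus> m \<in> topspace X" using m(1) MG neg_closed by auto
    define v where "v = \<ominus> m \<oplus> y"
    have v: "v \<in> topspace X" using mG m(2) add_closed by (simp add: v_def)
    have "m \<oplus> (v \<oplus> \<ominus> m) = y \<oplus> gyr m v (\<ominus> m)"
      using gyr_assoc[OF mG(1) v mG(2)] left_cancel'[OF mG(1) m(2)] by (simp add: v_def)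
    moreover have "gyr m v (\<ominus> m) \<in> M"
      using gyr_invariantD[OF _ mG(1) v mG(2)] M m(1) by (simp add: invariant_subgyrogroup_def)
    ultimately have "m \<oplus> (v \<oplus> \<ominus> m) \<in> coset y M"
      unfolding coset_eq_image[OF m(2) MG] by simp
    moreover have "m \<oplus> (v \<oplus> \<ominus> m) \<in> N" using m(3) T(3) by (auto simp: v_def)
    ultimately show ?thesis by blast
  qed
  ultimately show thesis by (rule that)
qed

text \<open>Sums of two elements of \<open>M\<close> lie in \<open>W\<close>, so Wallace's theorem
  yields a product neighbourhood of \<open>M \<times> M\<close> inside the preimage of
  \<open>W\<close> under addition.\<close>

lemma coset_in_open:
  assumes M: "invariant_subgyrogroup M" and "compactin X M" and W: "openin X W" "M \<subseteq> W"
  obtains U where "openin X U" "M \<subseteq> U" "\<And>z. z \<in> U \<Longrightarrow> coset z M \<subseteq> W"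
proof -
  have MG: "M \<subseteq> topspace X" using M by (rule subset_carrier)
  define S where "S = {p \<in> topspace (prod_topology X X). (\<lambda>(x, y). x \<oplus> y) p \<in> W}"
  have "openin (prod_topology X X) S"
    unfolding S_def by (rule openin_continuous_map_preimage[OF continuous_add W(1)])
  moreover have "M \<times> M \<subseteq> S"
    using M MG W(2) by (auto simp: S_def invariant_subgyrogroup_def)
  ultimately obtain U T where U: "openin X U" "openin X T" "M \<subseteq> U" "M \<subseteq> T" "U \<times> T \<subseteq> S"
    by (rule Wallace_theorem_prod_topology[OF assms(2,2)])
  have "coset z M \<subseteq> W" if "z \<in> U" for z
  proof -
    have z: "z \<in> topspace X" using that openin_subset[OF U(1)] by blast
    have "z \<oplus> m \<in> W" if "m \<in> M" for m
    proof -
      have "(z, m) \<in> S" using \<open>z \<in> U\<close> that U(4,5) by blast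
      then show ?thesis by (simp add: S_def)
    qed
    then show ?thesis unfolding coset_eq_image[OF z MG] by blast
  qed
  with U(1,3) show thesis by (rule that)
qed

end

section \<open>Successor and limit stages, and the maximal stage\<close>

context strongly_topological_gyrogroup
begin

text \<open>Remove a nonzero \<open>m\<close> from \<open>M\<close> by intersecting with a chain
  intersection \<open>P\<close>. Each old coset is replaced by a coset of \<open>M'\<close> inside
  it, through a representative as deep in the chain as possible, and the coset of \<open>m\<close>
  is added under the label \<open>M\<close>.\<close>

lemma stage_extend:
  assumes haus: "Hausdorff_space X" and H: "compactin X H"
    and st: "stage H M c" and nz: "M \<noteq> {\<zero>}"
  shows "\<exists>M' c'. stage H M' c' \<and> finer M' c' M c"
proof -
  note M = stageD(1)[OF st]
  have MG: "M \<subseteq> topspace X" using M by (rule subset_carrier)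
  have cM: "compactin X M" using closed_compactin[OF H stageD(3)[OF st] stageD(2)[OF st]] .
  have "\<zero> \<in> M" using M by (simp add: invariant_subgyrogroup_def)
  then obtain m where m: "m \<in> M" "m \<noteq> \<zero>" using nz by blast
  have mG: "m \<in> topspace X" using m(1) MG by blast
  have "openin X (topspace X - {m})" using closedin_Hausdorff_singleton[OF haus mG] by blast
  then have "nbhd (topspace X - {m})" using m(2) zero_closed by (intro nbhd_open) simp_all
  then obtain V where V: "gyr_chain V" "\<And>n. V n \<subseteq> topspace X - {m}"
    using gyr_chain_exists[of "\<lambda>_. topspace X - {m}"] by blast
  define P where "P = (\<Inter>n. V n)"
  define F where "F n = X closure_of (V n)" for n
  have F: "\<And>n. closedin X (F n)" "(\<Inter>n. F n) = P" "\<And>n. V n \<subseteq> F n"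
    using chain_Inter_closure[OF V(1)] closure_of_subset[OF chain_subset[OF V(1)]]
    by (simp_all add: F_def P_def)
  have decF: "decseq F"
    unfolding F_def decseq_def by (intro allI impI closure_of_mono decseqD[OF chain_decseq[OF V(1)]])
  define M' where "M' = M \<inter> P"
  have M': "invariant_subgyrogroup M'"
    using invariant_subgyrogroup_Inter[of "{M, P}"] M chain_subgroup[OF V(1)] by (auto simp: M'_def P_def)
  have "M' \<subseteq> M" by (simp add: M'_def)
  have clM': "closedin X M'"
    using stageD(2)[OF st] chain_Inter_closed[OF V(1)] by (simp add: M'_def P_def closedin_Int)
  have cM': "compactin X M'" by (rule closed_compactin[OF cM \<open>M' \<subseteq> M\<close> clM'])
  have "m \<notin> M'" using V(2)[of 0] by (auto simp: M'_def P_def)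
  \<comment> \<open>The coset \<open>c L\<close> is compact and the sets \<open>F n\<close> are
    nested, so a single point of it lies in all those \<open>F n\<close> that it meets.\<close>
  have ex: "\<exists>x. c L \<noteq> {} \<longrightarrow> x \<in> c L \<and> (\<forall>n. c L \<inter> F n \<noteq> {} \<longrightarrow> x \<in> F n)" for L
  proof (cases "c L = {} \<or> (\<forall>n. c L \<inter> F n = {})")
    case True
    then show ?thesis by blast
  next
    case False
    define \<C> where "\<C> = F ` {n. c L \<inter> F n \<noteq> {}}"
    have "c L \<inter> \<Inter>\<C> \<noteq> {}"
    proof (rule compactin_chain_Inter)
      show "compactin X (c L)"
        by (rule closed_compactin[OF H stageD(6)[OF st] stage_closed[OF st]])
      show "\<C> \<noteq> {}" using False by (auto simp: \<C>_def)
      show "closedin X C" if "C \<in> \<C>" for C using that F(1) by (auto simp: \<C>_def)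
      show "c L \<inter> C \<noteq> {}" if "C \<in> \<C>" for C using that by (auto simp: \<C>_def)
      show "C \<subseteq> D \<or> D \<subseteq> C" if CD: "C \<in> \<C>" "D \<in> \<C>" for C D
      proof -
        obtain i j where "C = F i" "D = F j" using CD by (auto simp: \<C>_def)
        then show ?thesis using decseqD[OF decF, of i j] decseqD[OF decF, of j i] nat_le_linear[of i j]
          by blast
      qed
    qed
    then show ?thesis by (auto simp: \<C>_def)
  qed
  obtain x where x: "\<And>L. c L \<noteq> {} \<Longrightarrow> x L \<in> c L"
    "\<And>L n. c L \<noteq> {} \<Longrightarrow> c L \<inter> F n \<noteq> {} \<Longrightarrow> x L \<in> F n"
  proof -
    obtain x where "\<forall>L. c L \<noteq> {} \<longrightarrow> x L \<in> c L \<and> (\<forall>n. c L \<inter> F n \<noteq> {} \<longrightarrow> x L \<in> F n)"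
      using choice[of "\<lambda>L x. c L \<noteq> {} \<longrightarrow> x \<in> c L \<and> (\<forall>n. c L \<inter> F n \<noteq> {} \<longrightarrow> x \<in> F n)"] ex by blast
    then show thesis using that[of x] by simp
  qed
  define c' where "c' L = (if c L \<noteq> {} then coset (x L) M' else if L = M then coset m M' else {})" for L
  have fresh: "c M = {}" by (rule stage_label_fresh[OF st])
  have xG: "x L \<in> topspace X" and cx: "c L = coset (x L) M" if "c L \<noteq> {}" for L
    using stage_coset[OF st x(1)[OF that]] by simp_all
  have c'sub: "c' L \<subseteq> c L" if "c L \<noteq> {}" for L
    using coset_mono[OF \<open>M' \<subseteq> M\<close>, of "x L"] cx[OF that] that by (simp add: c'_def)
  have c'M: "c' M \<subseteq> M"
    using coset_mono[OF \<open>M' \<subseteq> M\<close>, of m] coset_member[OF M m(1)] fresh by (simp add: c'_def)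
  have c'new: "c' L = {}" if "c L = {}" "L \<noteq> M" for L using that by (simp add: c'_def)
  have c'ne: "c' L \<noteq> {}" if "c L \<noteq> {}" for L
    using coset_refl[OF xG[OF that] M'] that by (auto simp: c'_def)
  have mc': "m \<in> c' M" using coset_refl[OF mG M'] fresh by (simp add: c'_def)
  have "stage H M' c'"
    unfolding stage_def
  proof (intro conjI allI impI M' clM')
    show "M' \<subseteq> H" using \<open>M' \<subseteq> M\<close> stageD(3)[OF st] by simp
    fix L
    show "\<exists>x\<in>topspace X. c' L = coset x M'" if "c' L \<noteq> {}"
      using that xG mG unfolding c'_def by (auto split: if_splits)
    show "c' L \<subseteq> L \<inter> H - M'"
    proof (cases "c L = {}")
      case False
      then show ?thesis
        using c'sub[OF False] stageD(5-7)[OF st, of L] \<open>M' \<subseteq> M\<close> by blast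
    next
      case True
      show ?thesis
      proof (cases "L = M")
        case True
        have "c' M \<inter> M' = {}" using coset_disjoint[OF M' mG \<open>m \<notin> M'\<close>] fresh by (simp add: c'_def)
        then show ?thesis using True c'M stageD(3)[OF st] by blast
      qed (use True c'new in simp)
    qed
  next
    fix W assume W: "openin X W" "M' \<subseteq> W"
    obtain U where U: "openin X U" "M' \<subseteq> U" "\<And>z. z \<in> U \<Longrightarrow> coset z M' \<subseteq> W"
      using coset_in_open[OF M' cM' W] by blast
    have "M \<inter> (\<Inter>n. F n) \<subseteq> U" using U(2) F(2) by (simp add: M'_def)
    then obtain n where n: "M \<inter> F n \<subseteq> U"
      using compactin_decseq_subset[OF cM F(1) decF U(1)] by blast
    have "openin X (U \<union> (topspace X - F n))"
      by (intro openin_Un U(1) openin_diff openin_topspace F(1))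
    moreover have "M \<subseteq> U \<union> (topspace X - F n)" using n MG by blast
    ultimately have fin1: "finite {L. \<not> c L \<subseteq> U \<union> (topspace X - F n)}" by (rule stageD(8)[OF st])
    obtain T where T: "openin X T" "M \<subseteq> T" "\<And>y. y \<in> T \<Longrightarrow> coset y M \<inter> V n \<noteq> {}"
      using coset_meets_nbhd[OF M chain_nbhd[OF V(1)]] by blast
    have fin2: "finite {L. \<not> c L \<subseteq> T}" by (rule stageD(8)[OF st T(1,2)])
    \<comment> \<open>For every other label, \<open>c L \<subseteq> T\<close> makes
      \<open>c L\<close> meet \<open>V n\<close>, so its deep representative is in
      \<open>F n\<close>. The first inclusion then puts the representative in \<open>U\<close>, and
      its \<open>M'\<close>-coset lies in \<open>W\<close>.\<close>
    have "{L. \<not> c' L \<subseteq> W} \<subseteq> insert M ({L. \<not> c L \<subseteq> U \<union> (topspace X - F n)} \<union> {L. \<not> c L \<subseteq> T})"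
    proof (rule subsetI, rule ccontr)
      fix L assume "L \<in> {L. \<not> c' L \<subseteq> W}"
        and "L \<notin> insert M ({L. \<not> c L \<subseteq> U \<union> (topspace X - F n)} \<union> {L. \<not> c L \<subseteq> T})"
      then have L: "\<not> c' L \<subseteq> W" "L \<noteq> M" "c L \<subseteq> U \<union> (topspace X - F n)" "c L \<subseteq> T" by simp_all
      have ne: "c L \<noteq> {}" using L(1,2) c'new by blast
      have "x L \<in> T" using x(1)[OF ne] L(4) by blast
      from T(3)[OF this] have "c L \<inter> F n \<noteq> {}" using cx[OF ne] F(3) by blast
      then have "x L \<in> F n" using x(2)[OF ne] by blast
      then have "x L \<in> U" using x(1)[OF ne] L(3) by blast
      from U(3)[OF this] show False using L(1) ne by (simp add: c'_def)
    qed
    then show "finite {L. \<not> c' L \<subseteq> W}" using fin1 fin2 by (simp add: finite_subset)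
  next
    assume "countable {L. c' L \<noteq> {}}"
    moreover have "{L. c L \<noteq> {}} \<subseteq> {L. c' L \<noteq> {}}" using c'ne by blast
    ultimately have "countable {L. c L \<noteq> {}}" by (rule countable_subset[rotated])
    then have "nbhd_gdelta M" by (rule stageD(9)[OF st])
    moreover have "nbhd_gdelta P" unfolding P_def by (rule chain_gdelta[OF V(1)])
    ultimately show "nbhd_gdelta M'" using nbhd_gdelta_Inter[of "{M, P}"] by (auto simp: M'_def)
  qed
  moreover have "finer M' c' M c"
    unfolding finer_def
  proof (intro conjI allI impI)
    show "c' M \<noteq> {}" using mc' by blast
    show "M' \<subseteq> M" by fact
    fix L
    show "c' L \<noteq> {}" "c' L \<subseteq> c L" if "c L \<noteq> {}" using c'ne[OF that] c'sub[OF that] by simp_all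
    show "L \<subseteq> M" if "c L = {}" "c' L \<noteq> {}" using c'new that by blast
  qed
  ultimately show ?thesis by blast
qed

text \<open>Intersect the subgyrogroups, and for each label the cosets of those stages that use it;
  compactness of \<open>H\<close> keeps these intersections nonempty. The hypothesis
  \<open>unbounded\<close> ensures that each subgyrogroup of the chain is itself a label in use at
  the limit.\<close>

lemma stage_limit:
  assumes H: "compactin X H"
    and st: "\<And>M c. (M, c) \<in> \<C> \<Longrightarrow> stage H M c"
    and ne: "\<C> \<noteq> {}"
    and total: "\<And>M1 c1 M2 c2. \<lbrakk>(M1, c1) \<in> \<C>; (M2, c2) \<in> \<C>\<rbrakk>
      \<Longrightarrow> (M1, c1) = (M2, c2) \<or> finer M1 c1 M2 c2 \<or> finer M2 c2 M1 c1"
    and unbounded: "\<And>M c. (M, c) \<in> \<C> \<Longrightarrow> \<exists>M' c'. (M', c') \<in> \<C> \<and> finer M' c' M c"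
  shows "\<exists>M' c'. stage H M' c' \<and> (\<forall>M c. (M, c) \<in> \<C> \<longrightarrow> finer M' c' M c)"
proof -
  define M' where "M' = \<Inter>(fst ` \<C>)"
  define A where "A L = {p \<in> \<C>. snd p L \<noteq> {}}" for L
  define c' where "c' L = (if A L = {} then {} else \<Inter>((\<lambda>p. snd p L) ` A L))" for L
  have M'_sub: "M' \<subseteq> M" if "(M, c) \<in> \<C>" for M c using that unfolding M'_def by force
  have A_mem: "(M, c) \<in> A L \<longleftrightarrow> (M, c) \<in> \<C> \<and> c L \<noteq> {}" for M c L by (simp add: A_def)
  have c'_sub: "c' L \<subseteq> c L" if "(M, c) \<in> A L" for M c L
  proof -
    have "c L \<in> (\<lambda>p. snd p L) ` A L" using that by (rule rev_image_eqI) simp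
    then show ?thesis using that unfolding c'_def by auto
  qed
  \<comment> \<open>A label in use somewhere but not at \<open>(M, c)\<close> is used only at finer
    stages, where new labels are subsets of \<open>M\<close>.\<close>
  have new: "L \<subseteq> M" if Mc: "(M, c) \<in> \<C>" and cL: "c L = {}" and AL: "A L \<noteq> {}" for M c L
  proof -
    obtain M2 c2 where 2: "(M2, c2) \<in> A L" using AL by fast
    have 3: "(M2, c2) \<in> \<C>" "c2 L \<noteq> {}" using 2 by (simp_all add: A_mem)
    have "finer M2 c2 M c" using total[OF Mc 3(1)] finerD(3)[of M c M2 c2 L] cL 3(2) by blast
    then show ?thesis using finerD(5)[of M2 c2 M c L] cL 3(2) by blast
  qed
  have cl: "closedin X M'"
    unfolding M'_def using ne stageD(2)[OF st] by (intro closedin_Inter) force+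
  have c'_ne: "c' L \<noteq> {}" if "A L \<noteq> {}" for L
  proof -
    have "H \<inter> \<Inter>((\<lambda>p. snd p L) ` A L) \<noteq> {}"
    proof (rule compactin_chain_Inter[OF H])
      show "(\<lambda>p. snd p L) ` A L \<noteq> {}" using that by simp
      fix C assume "C \<in> (\<lambda>p. snd p L) ` A L"
      then obtain M c where "(M, c) \<in> A L" "C = c L" by (metis imageE prod.collapse)
      then have C: "(M, c) \<in> \<C>" "c L \<noteq> {}" "C = c L" by (simp_all add: A_mem)
      show "closedin X C" using stage_closed[OF st[OF C(1)]] C(3) by simp
      show "H \<inter> C \<noteq> {}" using stageD(6)[OF st[OF C(1)], of L] C(2,3) by blast
      fix D assume "D \<in> (\<lambda>p. snd p L) ` A L"
      then obtain M2 c2 where "(M2, c2) \<in> A L" "D = c2 L" by (metis imageE prod.collapse)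
      then have D: "(M2, c2) \<in> \<C>" "c2 L \<noteq> {}" "D = c2 L" by (simp_all add: A_mem)
      show "C \<subseteq> D \<or> D \<subseteq> C"
        using total[OF C(1) D(1)] finerD(4)[of M c M2 c2 L] finerD(4)[of M2 c2 M c L] C D by blast
    qed
    then show ?thesis using that by (auto simp: c'_def)
  qed
  have c'_iff: "c' L \<noteq> {} \<longleftrightarrow> A L \<noteq> {}" for L using c'_ne[of L] by (auto simp: c'_def)
  \<comment> \<open>Stages not using \<open>L\<close> are coarser than every stage using it, so the
    latter have the same intersection as the whole chain.\<close>
  have M'_A: "M' = \<Inter>(fst ` A L)" if AL: "A L \<noteq> {}" for L
  proof
    show "M' \<subseteq> \<Inter>(fst ` A L)" unfolding M'_def by (rule Inter_anti_mono) (auto simp: A_def)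
    show "\<Inter>(fst ` A L) \<subseteq> M'"
      unfolding M'_def
    proof (rule Inter_greatest)
      fix N assume "N \<in> fst ` \<C>"
      then obtain d where N: "(N, d) \<in> \<C>" by force
      obtain M0 c0 where "(M0, c0) \<in> A L" using AL by fast
      then have 0: "(M0, c0) \<in> \<C>" "c0 L \<noteq> {}" by (simp_all add: A_mem)
      have "\<exists>M c. (M, c) \<in> A L \<and> M \<subseteq> N"
      proof (cases "d L = {}")
        case True
        then have "finer M0 c0 N d" using total[OF N 0(1)] 0(2) finerD(3)[of N d M0 c0 L] by blast
        from finerD(2)[OF this] show ?thesis using 0 A_mem by blast
      next
        case False
        then show ?thesis using N A_mem by blast
      qed
      then show "\<Inter>(fst ` A L) \<subseteq> N" by force
    qed
  qed
  have "stage H M' c'"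
    unfolding stage_def
  proof (intro conjI allI impI cl)
    show "invariant_subgyrogroup M'"
      unfolding M'_def using ne stageD(1)[OF st] by (intro invariant_subgyrogroup_Inter) force+
    obtain M0 c0 where 0: "(M0, c0) \<in> \<C>" using ne by fast
    show "M' \<subseteq> H" using M'_sub[OF 0] stageD(3)[OF st[OF 0]] by simp
    fix L
    show "\<exists>x\<in>topspace X. c' L = coset x M'" if c'L: "c' L \<noteq> {}"
    proof -
      obtain x where x: "x \<in> c' L" using c'L by blast
      have AL: "A L \<noteq> {}" using c'L c'_iff by simp
      \<comment> \<open>One point of \<open>c' L\<close> represents the cosets of all these stages,
        so intersecting the cosets amounts to intersecting the subgyrogroups.\<close>
      have eq: "snd p L = coset x (fst p) \<and> x \<in> topspace X" if "p \<in> A L" for p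
      proof -
        obtain M c where p: "p = (M, c)" by fastforce
        have Mc: "(M, c) \<in> A L" using that p by simp
        have "x \<in> c L" using c'_sub[OF Mc] x by blast
        then show ?thesis using stage_coset[OF st, of M c x L] Mc p by (simp add: A_mem)
      qed
      have "c' L = (\<Inter>p\<in>A L. coset x (fst p))"
        unfolding c'_def using AL eq by simp
      also have "\<dots> = coset x (\<Inter>(fst ` A L))"
        using coset_Inter[of "fst ` A L" x] AL by simp
      finally have "c' L = coset x M'" using M'_A[OF AL] by simp
      moreover have "x \<in> topspace X" using eq AL by blast
      ultimately show ?thesis by blast
    qed
    show "c' L \<subseteq> L \<inter> H - M'"
    proof (cases "A L = {}")
      case True
      then show ?thesis by (simp add: c'_def)
    next
      case False
      then obtain M c where Mc: "(M, c) \<in> A L" by fast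
      then have C: "(M, c) \<in> \<C>" by (simp add: A_mem)
      show ?thesis using c'_sub[OF Mc] stageD(5-7)[OF st[OF C], of L] M'_sub[OF C] by blast
    qed
  next
    fix W assume W: "openin X W" "M' \<subseteq> W"
    have "\<exists>C\<in>fst ` \<C>. H \<inter> C \<subseteq> W"
    proof (rule compactin_chain_subset[OF H _ _ _ W(1)])
      show "fst ` \<C> \<noteq> {}" using ne by simp
      show "H \<inter> \<Inter>(fst ` \<C>) \<subseteq> W" using W(2) unfolding M'_def by blast
      fix C assume "C \<in> fst ` \<C>"
      then obtain c where C: "(C, c) \<in> \<C>" by force
      show "closedin X C" by (rule stageD(2)[OF st[OF C]])
      fix D assume "D \<in> fst ` \<C>"
      then obtain d where D: "(D, d) \<in> \<C>" by force
      show "C \<subseteq> D \<or> D \<subseteq> C" using total[OF C D] finerD(2)[of C c D d] finerD(2)[of D d C c] by blast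
    qed
    then obtain M c where Mc: "(M, c) \<in> \<C>" "H \<inter> M \<subseteq> W" by force
    then have MW: "M \<subseteq> W" using stageD(3)[OF st[OF Mc(1)]] by blast
    \<comment> \<open>Limit cosets whose label was already used at \<open>(M, c)\<close> only
      shrink, while the others lie in \<open>L \<subseteq> M \<subseteq> W\<close>. So no new
      exceptions arise.\<close>
    have "{L. \<not> c' L \<subseteq> W} \<subseteq> {L. \<not> c L \<subseteq> W}"
    proof (rule subsetI, rule ccontr)
      fix L assume "L \<in> {L. \<not> c' L \<subseteq> W}" and "L \<notin> {L. \<not> c L \<subseteq> W}"
      then have L: "\<not> c' L \<subseteq> W" "c L \<subseteq> W" by simp_all
      then have "A L \<noteq> {}" using c'_iff by blast
      show False
      proof (cases "c L = {}")
        case True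
        have LM: "L \<subseteq> M" by (rule new[OF Mc(1) True \<open>A L \<noteq> {}\<close>])
        obtain M2 c2 where 2: "(M2, c2) \<in> A L" using \<open>A L \<noteq> {}\<close> by fast
        then have "c2 L \<subseteq> L" using stageD(5)[OF st, of M2 c2 L] by (simp add: A_mem)
        then show False using c'_sub[OF 2] LM MW L(1) by blast
      next
        case False
        then show False using c'_sub[of M c L] Mc(1) L A_mem by blast
      qed
    qed
    then show "finite {L. \<not> c' L \<subseteq> W}" using stageD(8)[OF st[OF Mc(1)] W(1) MW] by (rule finite_subset)
  next
    assume cnt: "countable {L. c' L \<noteq> {}}"
    \<comment> \<open>The map from subgyrogroups of the chain to labels is the identity here, so
      countably many labels leave only countably many sets to intersect.\<close>
    have "fst ` \<C> \<subseteq> {L. c' L \<noteq> {}}"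
    proof
      fix M assume "M \<in> fst ` \<C>"
      then obtain c where "(M, c) \<in> \<C>" by force
      then obtain M2 c2 where "(M2, c2) \<in> \<C>" "finer M2 c2 M c" using unbounded by blast
      then have "(M2, c2) \<in> A M" using finerD(1) by (simp add: A_mem)
      then show "M \<in> {L. c' L \<noteq> {}}" using c'_iff by blast
    qed
    then have "countable (fst ` \<C>)" using cnt by (rule countable_subset)
    then show "nbhd_gdelta M'"
      unfolding M'_def
    proof (rule nbhd_gdelta_Inter)
      show "fst ` \<C> \<noteq> {}" using ne by simp
      fix M assume "M \<in> fst ` \<C>"
      then obtain c where Mc: "(M, c) \<in> \<C>" by force
      have "{L. c L \<noteq> {}} \<subseteq> {L. c' L \<noteq> {}}"
      proof
        fix L assume "L \<in> {L. c L \<noteq> {}}"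
        then have "(M, c) \<in> A L" using Mc by (simp add: A_mem)
        then show "L \<in> {L. c' L \<noteq> {}}" using c'_iff by blast
      qed
      then have "countable {L. c L \<noteq> {}}" using cnt by (rule countable_subset)
      then show "nbhd_gdelta M" by (rule stageD(9)[OF st[OF Mc]])
    qed
  qed
  moreover have "finer M' c' M c" if Mc: "(M, c) \<in> \<C>" for M c
    unfolding finer_def
  proof (intro conjI allI impI)
    obtain M2 c2 where 2: "(M2, c2) \<in> \<C>" "finer M2 c2 M c" using unbounded[OF Mc] by blast
    then have "(M2, c2) \<in> A M" using finerD(1)[OF 2(2)] by (simp add: A_mem)
    then show "c' M \<noteq> {}" using c'_iff by blast
    show "M' \<subseteq> M" by (rule M'_sub[OF Mc])
    fix L
    show "c' L \<noteq> {}" "c' L \<subseteq> c L" if "c L \<noteq> {}"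
    proof -
      have "(M, c) \<in> A L" using Mc that by (simp add: A_mem)
      then show "c' L \<noteq> {}" "c' L \<subseteq> c L" using c'_iff[of L] c'_sub by blast+
    qed
    show "L \<subseteq> M" if "c L = {}" "c' L \<noteq> {}" using new[OF Mc that(1)] c'_iff that(2) by simp
  qed
  ultimately show ?thesis by blast
qed

text \<open>Zorn's lemma gives a maximal stage; \<open>stage_extend\<close> forces its subgyrogroup
  to be \<open>{\<zero>}\<close>, and the countability clause of \<open>stage\<close> then makes its
  set of labels uncountable. Its cosets are singletons.\<close>

lemma uncountable_convergent_family:
  assumes haus: "Hausdorff_space X" and H: "compactin X H"
    and subH: "invariant_subgyrogroup H" and clH: "closedin X H" and gH: "nbhd_gdelta H"
    and nG: "\<not> nbhd_gdelta {\<zero>}"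
  obtains I :: "'a set set" and e where "uncountable I" "\<And>i. i \<in> I \<Longrightarrow> e i \<in> topspace X"
    "\<And>i. i \<in> I \<Longrightarrow> e i \<noteq> \<zero>" "\<And>W. openin X W \<Longrightarrow> \<zero> \<in> W \<Longrightarrow> finite {i \<in> I. e i \<notin> W}"
proof -
  define S where "S = {p. stage H (fst p) (snd p)}"
  define R where "R p q \<longleftrightarrow> p = q \<or> finer (fst q) (snd q) (fst p) (snd p)" for p q :: "'a set \<times> ('a set \<Rightarrow> 'a set)"
  have mem: "(M, c) \<in> S \<longleftrightarrow> stage H M c" for M c by (simp add: S_def)
  have init: "(H, \<lambda>_. {}) \<in> S"
    using subH clH gH by (simp add: mem stage_def)
  have irrefl: "\<not> finer M c M c" if "stage H M c" for M c
    using stage_label_fresh[OF that] finerD(1)[of M c M c] by blast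
  have "\<exists>m\<in>S. \<forall>a\<in>S. R m a \<longrightarrow> a = m"
  proof (rule predicate_Zorn)
    show "partial_order_on S (relation_of R S)"
    proof (rule partial_order_on_relation_ofI)
      show "R a a" for a by (simp add: R_def)
      show "R a c" if "a \<in> S" "b \<in> S" "c \<in> S" "R a b" "R b c" for a b c
        using that(4,5) finer_trans[of "fst c" "snd c" "fst b" "snd b" "fst a" "snd a"] by (auto simp: R_def)
      show "a = b" if "a \<in> S" "b \<in> S" "R a b" "R b a" for a b
      proof (rule ccontr)
        assume "a \<noteq> b"
        then have "finer (fst a) (snd a) (fst a) (snd a)"
          using that(3,4) finer_trans[of "fst a" "snd a" "fst b" "snd b" "fst a" "snd a"] by (simp add: R_def)
        then show False using irrefl that(1) by (simp add: S_def)
      qed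
    qed
    fix \<C> assume chain: "\<C> \<in> Chains (relation_of R S)"
    have sub: "\<And>p. p \<in> \<C> \<Longrightarrow> p \<in> S" and cmp: "\<And>p q. p \<in> \<C> \<Longrightarrow> q \<in> \<C> \<Longrightarrow> R p q \<or> R q p"
      using chain unfolding Chains_def relation_of_def by blast+
    show "\<exists>u\<in>S. \<forall>a\<in>\<C>. R a u"
    \<comment> \<open>A chain without a greatest member is exactly what \<open>stage_limit\<close>
      handles; the empty chain is bounded by the initial stage.\<close>
    proof (cases "\<exists>u\<in>\<C>. \<forall>a\<in>\<C>. R a u")
      case True
      then show ?thesis using sub by blast
    next
      case False
      show ?thesis
      proof (cases "\<C> = {}")
        case True
        then show ?thesis using init by blast
      next
        case ne: False
        have "\<exists>M' c'. stage H M' c' \<and> (\<forall>M c. (M, c) \<in> \<C> \<longrightarrow> finer M' c' M c)"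
        proof (rule stage_limit[OF H _ ne])
          show "stage H M c" if "(M, c) \<in> \<C>" for M c using sub[OF that] by (simp add: mem)
          show "(M1, c1) = (M2, c2) \<or> finer M1 c1 M2 c2 \<or> finer M2 c2 M1 c1"
            if "(M1, c1) \<in> \<C>" "(M2, c2) \<in> \<C>" for M1 c1 M2 c2
            using cmp[OF that] by (auto simp: R_def)
          show "\<exists>M' c'. (M', c') \<in> \<C> \<and> finer M' c' M c" if Mc: "(M, c) \<in> \<C>" for M c
          proof -
            obtain a where a: "a \<in> \<C>" "\<not> R a (M, c)" using False Mc by blast
            then have "R (M, c) a" using cmp[OF a(1) Mc] by blast
            moreover have "a \<noteq> (M, c)" using a(2) by (auto simp: R_def)
            ultimately have "finer (fst a) (snd a) M c" by (auto simp: R_def)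
            then show ?thesis using a(1) by (metis prod.collapse)
          qed
        qed
        then obtain M' c' where u: "stage H M' c'" "\<forall>M c. (M, c) \<in> \<C> \<longrightarrow> finer M' c' M c" by blast
        have "R a (M', c')" if "a \<in> \<C>" for a
          using u(2) that by (cases a) (simp add: R_def)
        then show ?thesis using u(1) mem by blast
      qed
    qed
  qed
  then obtain M c where "stage H M c" and max: "\<And>M' c'. stage H M' c' \<Longrightarrow> \<not> finer M' c' M c"
  proof -
    assume thesis: "\<And>M c. stage H M c \<Longrightarrow> (\<And>M' c'. stage H M' c' \<Longrightarrow> \<not> finer M' c' M c) \<Longrightarrow> thesis"
    assume "\<exists>m\<in>S. \<forall>a\<in>S. R m a \<longrightarrow> a = m"
    then obtain m where m: "m \<in> S" "\<forall>a\<in>S. R m a \<longrightarrow> a = m" by blast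
    show thesis
    proof (rule thesis)
      show st: "stage H (fst m) (snd m)" using m(1) by (simp add: S_def)
      show "\<not> finer M' c' (fst m) (snd m)" if "stage H M' c'" for M' c'
      proof
        assume f: "finer M' c' (fst m) (snd m)"
        then have "R m (M', c')" by (simp add: R_def)
        then have "(M', c') = m" using m(2) that mem by blast
        then show False using f irrefl[OF st] by (metis fst_conv snd_conv)
      qed
    qed
  qed
  note st = \<open>stage H M c\<close>
  have "M = {\<zero>}" using stage_extend[OF haus H st] max by blast
  define I where "I = {L. c L \<noteq> {}}"
  define e where "e L = (SOME x. x \<in> c L)" for L
  have e: "e L \<in> c L" if "L \<in> I" for L
    using that someI_ex[of "\<lambda>x. x \<in> c L"] by (auto simp: e_def I_def)
  show thesis
  proof (rule that[of I e])
    show "uncountable I" using stageD(9)[OF st] nG \<open>M = {\<zero>}\<close> by (auto simp: I_def)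
    show "e i \<in> topspace X" if "i \<in> I" for i
      using stage_coset(2)[OF st e[OF that]] .
    show "e i \<noteq> \<zero>" if "i \<in> I" for i
      using e[OF that] stageD(7)[OF st, of i] \<open>M = {\<zero>}\<close> by auto
    fix W assume W: "openin X W" "\<zero> \<in> W"
    have "finite {L. \<not> c L \<subseteq> W}" using stageD(8)[OF st W(1)] W(2) \<open>M = {\<zero>}\<close> by simp
    moreover have "{i \<in> I. e i \<notin> W} \<subseteq> {L. \<not> c L \<subseteq> W}" using e by blast
    ultimately show "finite {i \<in> I. e i \<notin> W}" by (rule finite_subset[rotated])
  qed
qed

end

subsection \<open>Uncountable families and cs*-networks\<close>

text \<open>Each finite subfamily of the network that covers almost all \<open>e i\<close> omits
  only countably many indices even when all such subfamilies are taken together. A remaining index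
  \<open>i\<close> is refuted by the open set that removes \<open>e i\<close>.\<close>

lemma no_uncountable_family_converging:
  assumes T1: "t1_space X" and x: "x \<in> topspace X"
    and \<N>: "countable \<N>" "cs_star_network_at X x \<N>"
    and I: "uncountable I" "\<And>i. i \<in> I \<Longrightarrow> e i \<in> topspace X" "\<And>i. i \<in> I \<Longrightarrow> e i \<noteq> x"
    and conv: "\<And>W. openin X W \<Longrightarrow> x \<in> W \<Longrightarrow> finite {i \<in> I. e i \<notin> W}"
  shows False
proof -
  have network: "\<exists>N\<in>\<N>. N \<subseteq> U \<and> infinite {n. \<xi> n \<in> N}"
    if "openin X U" "x \<in> U" "range \<xi> \<subseteq> topspace X" "limitin X \<xi> x sequentially"
    for U and \<xi> :: "nat \<Rightarrow> 'a"
  proof -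
    have "neighborhood_of X x U" using that openin_subset unfolding neighborhood_of_def by blast
    then show ?thesis using \<N>(2) that(3,4) unfolding cs_star_network_at_def by blast
  qed
  have fin: "\<exists>\<F>. finite \<F> \<and> \<F> \<subseteq> \<N> \<and> \<Union>\<F> \<subseteq> U \<and> finite {i \<in> I. e i \<notin> \<Union>\<F>}"
    if U: "openin X U" "x \<in> U" for U
  proof (rule ccontr)
    assume no: "\<not> ?thesis"
    define \<M> where "\<M> = {N \<in> \<N>. N \<subseteq> U}"
    \<comment> \<open>The constant sequence at \<open>x\<close> provides a member, so that
      \<open>\<M>\<close> can be enumerated.\<close>
    have "\<M> \<noteq> {}"
      using network[OF U, of "\<lambda>_. x"] x by (auto simp: \<M>_def)
    moreover have "countable \<M>" using \<N>(1) by (simp add: \<M>_def)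
    ultimately have g: "range (from_nat_into \<M>) = \<M>" by (rule range_from_nat_into)
    define F where "F k = \<Union>(from_nat_into \<M> ` {..k})" for k
    have inf: "infinite {i \<in> I. e i \<notin> F k}" for k
    proof -
      define \<F> where "\<F> = from_nat_into \<M> ` {..k}"
      have "\<F> \<subseteq> \<M>" using g by (auto simp: \<F>_def)
      then have "finite \<F>" "\<F> \<subseteq> \<N>" "\<Union>\<F> \<subseteq> U" by (auto simp: \<F>_def \<M>_def)
      then have "infinite {i \<in> I. e i \<notin> \<Union>\<F>}" using no by metis
      then show ?thesis unfolding F_def \<F>_def .
    qed
    \<comment> \<open>The indices are chosen distinct, so that the points converge to
      \<open>x\<close>, and the \<open>k\<close>-th point avoids the first \<open>k + 1\<close>
      members of \<open>\<M>\<close>.\<close>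
    have "\<exists>f. \<forall>k. f k \<in> {i \<in> I. e i \<notin> F k} - f ` {..<k}"
    proof (rule dependent_wellorder_choice)
      fix r and f g :: "nat \<Rightarrow> 'b" and k assume "\<And>y. y < k \<Longrightarrow> f y = g y"
      then have "f ` {..<k} = g ` {..<k}" by simp
      then show "(r \<in> {i \<in> I. e i \<notin> F k} - f ` {..<k}) = (r \<in> {i \<in> I. e i \<notin> F k} - g ` {..<k})" by simp
    next
      fix k and f :: "nat \<Rightarrow> 'b"
      have "infinite ({i \<in> I. e i \<notin> F k} - f ` {..<k})" using inf by (intro Diff_infinite_finite) simp_all
      then show "\<exists>r. r \<in> {i \<in> I. e i \<notin> F k} - f ` {..<k}" using infinite_imp_nonempty by blast
    qed
    then obtain f where f: "\<And>k. f k \<in> I" "\<And>k. e (f k) \<notin> F k" "\<And>j k. j < k \<Longrightarrow> f k \<noteq> f j" by blast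
    have "inj f" by (rule linorder_injI) (use f(3) in metis)
    have "limitin X (\<lambda>k. e (f k)) x sequentially"
      unfolding limitin_def
    proof (intro conjI allI impI x)
      fix W assume "openin X W \<and> x \<in> W"
      then have "finite {i \<in> I. e i \<notin> W}" using conv by blast
      then have "finite (f -` {i \<in> I. e i \<notin> W})" using \<open>inj f\<close> by (rule finite_vimageI)
      moreover have "f -` {i \<in> I. e i \<notin> W} = {k. e (f k) \<notin> W}" using f(1) by auto
      ultimately show "\<forall>\<^sub>F k in sequentially. e (f k) \<in> W"
        unfolding cofinite_eq_sequentially[symmetric] eventually_cofinite by simp
    qed
    moreover have "range (\<lambda>k. e (f k)) \<subseteq> topspace X" using f(1) I(2) by blast
    ultimately obtain N where N: "N \<in> \<N>" "N \<subseteq> U" "infinite {k. e (f k) \<in> N}"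
      using network[OF U, of "\<lambda>k. e (f k)"] by blast
    then obtain m where m: "N = from_nat_into \<M> m" using g unfolding \<M>_def by blast
    \<comment> \<open>The set \<open>N\<close> has number \<open>m\<close>, hence lies in
      \<open>F k\<close> for all \<open>k\<close> from \<open>m\<close> on, and
      \<open>e (f k)\<close> avoids it.\<close>
    have "{k. e (f k) \<in> N} \<subseteq> {..<m}"
    proof
      fix k assume k: "k \<in> {k. e (f k) \<in> N}"
      show "k \<in> {..<m}"
      proof (rule ccontr)
        assume "k \<notin> {..<m}"
        then have "m \<in> {..k}" by simp
        then have "N \<subseteq> F k" unfolding F_def m by (intro Union_upper imageI)
        then show False using k f(2) by blast
      qed
    qed
    then show False using N(3) finite_subset by blast
  qed
  define \<G> where "\<G> = {\<F>. \<F> \<subseteq> \<N> \<and> finite \<F> \<and> finite {i \<in> I. e i \<notin> \<Union>\<F>}}"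
  have "countable {\<F>. finite \<F> \<and> \<F> \<subseteq> \<N>}" using \<N>(1) by (rule countable_Collect_finite_subset)
  then have "countable \<G>" by (rule countable_subset[rotated]) (auto simp: \<G>_def)
  define J where "J = (\<Union>\<F>\<in>\<G>. {i \<in> I. e i \<notin> \<Union>\<F>})"
  have "countable J"
    unfolding J_def using \<open>countable \<G>\<close> by (rule countable_UN) (simp add: \<G>_def countable_finite)
  then have "\<not> I \<subseteq> J" using I(1) by (auto dest: countable_subset)
  then obtain i where i: "i \<in> I" "i \<notin> J" by blast
  have iG: "e i \<in> \<Union>\<F>" if "\<F> \<in> \<G>" for \<F>
  proof (rule ccontr)
    assume "e i \<notin> \<Union>\<F>"
    then have "i \<in> J" unfolding J_def using i(1) that by (intro UN_I[of \<F>]) simp_all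
    then show False using i(2) by contradiction
  qed
  have "openin X (topspace X - {e i})" "x \<in> topspace X - {e i}"
    using T1 I(2)[OF i(1)] x I(3)[OF i(1)] unfolding t1_space_closedin_singleton by blast+
  from fin[OF this] obtain \<F> where \<F>: "finite \<F>" "\<F> \<subseteq> \<N>" "\<Union>\<F> \<subseteq> topspace X - {e i}"
    "finite {i \<in> I. e i \<notin> \<Union>\<F>}" by (elim exE conjE)
  have "\<F> \<in> \<G>" unfolding \<G>_def using \<F>(1,2,4) by simp
  from subsetD[OF \<F>(3) iG[OF this]] show False by simp
qed

section \<open>Moving the feathered set to the identity, and the conclusion\<close>

context topological_gyrogroup
begin

text \<open>For \<open>a\<close> in the given compact set, left addition of
  \<open>\<ominus> a\<close> is a homeomorphism with inverse left addition of \<open>a\<close>; it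
  carries the set and its countable outer base to ones around \<open>\<zero>\<close>.\<close>

lemma feathered_at_zero:
  assumes "feathered X"
  obtains K B where "compactin X K" "\<zero> \<in> K" "\<And>n::nat. openin X (B n)" "\<And>n. K \<subseteq> B n"
    "\<And>W. openin X W \<Longrightarrow> K \<subseteq> W \<Longrightarrow> \<exists>n. B n \<subseteq> W"
proof -
  obtain K \<B> where K: "K \<noteq> {}" "compactin X K" and \<B>: "countable \<B>" "\<And>B. B \<in> \<B> \<Longrightarrow> openin X B"
    "\<And>B. B \<in> \<B> \<Longrightarrow> K \<subseteq> B" "\<And>W. openin X W \<Longrightarrow> K \<subseteq> W \<Longrightarrow> \<exists>B\<in>\<B>. B \<subseteq> W"
    using assms unfolding feathered_def countable_character_in_def by metis
  have KG: "K \<subseteq> topspace X" using K(2) by (rule compactin_subset_topspace)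
  obtain a where a: "a \<in> K" using K(1) by blast
  then have aG: "a \<in> topspace X" "\<ominus> a \<in> topspace X" using KG neg_closed by auto
  have ne: "\<B> \<noteq> {}" using \<B>(4)[OF openin_topspace KG] by blast
  define T where "T y = \<ominus> a \<oplus> y" for y
  have T: "continuous_map X X T" unfolding T_def by (rule continuous_map_left_add[OF aG(2)])
  define B where "B n = {y \<in> topspace X. a \<oplus> y \<in> from_nat_into \<B> n}" for n
  have mem: "from_nat_into \<B> n \<in> \<B>" for n by (rule from_nat_into[OF ne])
  show thesis
  proof (rule that[of "T ` K" B])
    show "compactin X (T ` K)" by (rule image_compactin[OF K(2) T])
    show "\<zero> \<in> T ` K" using a neg_inverse[OF aG(1)] by (auto simp: T_def image_iff intro!: bexI[of _ a])
    show "openin X (B n)" for n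
      unfolding B_def by (rule openin_continuous_map_preimage[OF continuous_map_left_add[OF aG(1)] \<B>(2)[OF mem]])
    show "T ` K \<subseteq> B n" for n
    proof
      fix y assume "y \<in> T ` K"
      then obtain k where k: "k \<in> K" "y = \<ominus> a \<oplus> k" by (auto simp: T_def)
      have kG: "k \<in> topspace X" using k(1) KG by blast
      have "a \<oplus> y = k" using left_cancel'[OF aG(1) kG] k(2) by simp
      moreover have "k \<in> from_nat_into \<B> n" using \<B>(3)[OF mem] k(1) by blast
      ultimately show "y \<in> B n" using add_closed[OF aG(2) kG] k(2) by (simp add: B_def)
    qed
    show "\<exists>n. B n \<subseteq> W" if W: "openin X W" "T ` K \<subseteq> W" for W
    proof -
      have "openin X {y \<in> topspace X. T y \<in> W}" by (rule openin_continuous_map_preimage[OF T W(1)])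
      moreover have "K \<subseteq> {y \<in> topspace X. T y \<in> W}" using W(2) KG by blast
      ultimately obtain C where C: "C \<in> \<B>" "C \<subseteq> {y \<in> topspace X. T y \<in> W}" using \<B>(4) by blast
      obtain n where n: "from_nat_into \<B> n = C" using from_nat_into_surj[OF \<B>(1) C(1)] by blast
      have "y \<in> W" if "y \<in> B n" for y
      proof -
        have "y \<in> topspace X" "T (a \<oplus> y) \<in> W" using that C(2) n by (auto simp: B_def)
        then show ?thesis using left_cancel[OF aG(1)] by (simp add: T_def)
      qed
      then show ?thesis by blast
    qed
  qed
qed

end

theorem theorem3p14:
  fixes X :: "'a topology"
    and add :: "'a \<Rightarrow> 'a \<Rightarrow> 'a" and zero :: 'a and neg :: "'a \<Rightarrow> 'a"
    and gyr :: "'a \<Rightarrow> 'a \<Rightarrow> 'a \<Rightarrow> 'a"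
  assumes "strongly_topological_gyrogroup X add zero neg gyr"
    and "Hausdorff_space X"
    and "feathered X"
    and "countable_cs_star_character_at X zero"
  shows "metrizable_space X"
proof -
  interpret strongly_topological_gyrogroup X add zero neg gyr by fact
  note haus = \<open>Hausdorff_space X\<close>
  obtain K B where K: "compactin X K" "zero \<in> K" and B: "\<And>n::nat. openin X (B n)" "\<And>n. K \<subseteq> B n"
    "\<And>W. openin X W \<Longrightarrow> K \<subseteq> W \<Longrightarrow> \<exists>n. B n \<subseteq> W"
    using feathered_at_zero[OF assms(3)] by blast
  have nB: "nbhd (B n)" for n using nbhd_open[OF B(1)] B(2) K(2) by blast
  \<comment> \<open>The intersection of this chain is the compact subgyrogroup \<open>H\<close> from
    which the stages start.\<close>
  obtain V where V: "gyr_chain V" "\<And>n. V n \<subseteq> B n" using gyr_chain_exists[of B, OF nB] by metis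
  have H: "compactin X (\<Inter>n. V n)" by (rule chain_outer_base(1)[OF V(1) haus K(1) B V(2)])
  have "nbhd_gdelta {zero}"
  proof (rule ccontr)
    assume "\<not> nbhd_gdelta {zero}"
    then obtain I :: "'a set set" and e where I: "uncountable I" "\<And>i. i \<in> I \<Longrightarrow> e i \<in> topspace X"
      "\<And>i. i \<in> I \<Longrightarrow> e i \<noteq> zero" "\<And>W. openin X W \<Longrightarrow> zero \<in> W \<Longrightarrow> finite {i \<in> I. e i \<notin> W}"
      using uncountable_convergent_family[OF haus H chain_subgroup[OF V(1)] chain_Inter_closed[OF V(1)]
          chain_gdelta[OF V(1)]] by metis
    obtain \<N> where "countable \<N>" "cs_star_network_at X zero \<N>"
      using assms(4) unfolding countable_cs_star_character_at_def by blast
    then show False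
      using no_uncountable_family_converging[OF Hausdorff_imp_t1_space[OF haus] zero_closed _ _ I] by blast
  qed
  then obtain \<U> where \<U>: "countable \<U>" "\<U> \<noteq> {}" "\<And>U. U \<in> \<U> \<Longrightarrow> nbhd U" "{zero} = \<Inter>\<U>"
    unfolding nbhd_gdelta_def by metis
  \<comment> \<open>Intersecting with \<open>B n\<close> makes \<open>chain_outer_base\<close>
    applicable to a chain whose intersection is only the identity, so that the chain is a base
    there.\<close>
  have "nbhd (from_nat_into \<U> n \<inter> B n)" for n
    using \<U>(3)[OF from_nat_into[OF \<U>(2)]] nB by (rule nbhd_Int)
  then obtain V' where V': "gyr_chain V'" "\<And>n. V' n \<subseteq> from_nat_into \<U> n \<inter> B n"
    using gyr_chain_exists[of "\<lambda>n. from_nat_into \<U> n \<inter> B n"] by blast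
  have "(\<Inter>n. V' n) \<subseteq> {zero}"
  proof -
    have "(\<Inter>n. V' n) \<subseteq> (\<Inter>n. from_nat_into \<U> n)" using V'(2) by blast
    also have "\<dots> = \<Inter>\<U>" using range_from_nat_into[OF \<U>(2,1)] by simp
    finally show ?thesis using \<U>(4) by simp
  qed
  have "V' n \<subseteq> B n" for n using V'(2) by blast
  from chain_outer_base(2)[OF V'(1) haus K(1) B this]
  have "\<exists>n. V' n \<subseteq> W" if "openin X W" "zero \<in> W" for W
    using that \<open>(\<Inter>n. V' n) \<subseteq> {zero}\<close> by blast
  then show ?thesis by (rule metrizable_if_chain_base[OF V'(1) haus])
qed

end
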